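(* Let $\{X_n,n\ge1\}$ be a martingale difference sequence with respect to an increasing sequence of $\sigma$-fields $\{\mathcal{F}_n,n\ge0\}$, and let $S_n=X_1+\cdots+X_n$ and $V_n=(X_1^2+\cdots+X_n^2)^{1/2}$. Suppose that $|X_n|\le m_n$ a.s. for some $\mathcal{F}_{n-1}$-measurable random variable $m_n$ $(n\ge1)$, with $V_n\to\infty$ a.s. and $m_n/\{V_n(\log\log V_n)^{-1/2}\}\to0$ a.s. Then $$\limsup_{n\to\infty}\frac{S_n}{V_n(\log\log V_n)^{1/2}}=\sqrt2\quad\text{a.s.}$$
   Context: Expressions involving $\log\log V_n$ are considered only for those $n$ with $V_n>e$, i.e. for all large $n$ almost surely. *)

theory Defs
  imports "HOL-Probability.Probability"
begin

text \<open>
  Sequences indexed by positive integers are functions on \<^typ>\<open>nat\<close> whose value at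
  \<open>0\<close> is never used; the sigma-fields \<open>F n\<close> are indexed from \<open>0\<close>.
\<close>

definition martingale_difference_seq ::
  "'a measure \<Rightarrow> (nat \<Rightarrow> 'a measure) \<Rightarrow> (nat \<Rightarrow> 'a \<Rightarrow> real) \<Rightarrow> bool" where
  "martingale_difference_seq M F X \<longleftrightarrow>
     filtration (space M) F \<and> (\<forall>n. subalgebra M (F n)) \<and>
     (\<forall>n\<ge>1. X n \<in> borel_measurable (F n) \<and> integrable M (X n) \<and>
       (AE \<omega> in M. real_cond_exp M (F (n - 1)) (X n) \<omega> = 0))"

definition partial_sum :: "(nat \<Rightarrow> 'a \<Rightarrow> real) \<Rightarrow> nat \<Rightarrow> 'a \<Rightarrow> real" where
  "partial_sum X n \<omega> = (\<Sum>i=1..n. X i \<omega>)"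

definition self_norm :: "(nat \<Rightarrow> 'a \<Rightarrow> real) \<Rightarrow> nat \<Rightarrow> 'a \<Rightarrow> real" where
  "self_norm X n \<omega> = sqrt (\<Sum>i=1..n. (X i \<omega>)\<^sup>2)"

text \<open>
  Where \<open>self_norm X n \<omega> \<le> exp 1\<close>, the expression \<open>ln (ln (self_norm X n \<omega>))\<close> has no
  mathematical meaning but still denotes a real. This is harmless: the self-norm tends to
  infinity almost surely, and limits and limits superior ignore finitely many indices.
\<close>

end

theory Submission
  imports Defs "HOL-Real_Asymp.Real_Asymp"
begin

text \<open>
Write \<open>S n\<close> for the partial sums, \<open>V n\<close> for the self-norms and \<open>loglog v = ln (ln v)\<close>. The proof uses
no conditional variances: the self-norm itself compensates an exponential of \<open>S n\<close>. For every
\<open>e > 0\<close> and all sufficiently small \<open>y\<close>,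
\<open>exp (y - (1 + e) * y\<^sup>2 / 2) \<le> 1 + y\<close> and \<open>1 + y \<le> exp (y - (1 - e) * y\<^sup>2 / 2)\<close>,
so if \<open>y i = s i * X i\<close> are the small gains of a predictable stake \<open>s\<close>, the exponential of
\<open>(\<Sum>i. y i) - (1 + e) * (\<Sum>i. (y i)\<^sup>2) / 2\<close> never increases by more than a fair bet on \<open>X i\<close>, and with
\<open>1 - e\<close> it increases by at least a fair bet. The random bounds \<open>m i\<close> are predictable, hence a stake
may be withdrawn as soon as \<open>m i\<close> is too large for the expansion; the hypothesis on \<open>m\<close> says that
on almost every path this never happens at large scales (\<open>regular_path_stakes_small\<close>).

Apart from the Borel-Cantelli lemma, all probability enters through one observation
(\<open>betting_inequality\<close>): a gambler who starts with
capital \<open>1\<close>, makes bounded predictable bets on the \<open>X i\<close> and is never in debt has expected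
capital \<open>1\<close>, so the capital reaches \<open>c\<close> with probability at most \<open>1 / c\<close>.

For the upper half, the gambler uses the stake \<open>sqrt (2 * loglog t) / t\<close>, where \<open>t = \<beta> ^ k\<close> up
to a constant factor, and \<open>\<beta>\<close> is close to \<open>1\<close>. The maximal inequality bounds by \<open>(k * ln \<beta>) powr - (1 + e)\<close>
the probability that the capital ever reaches \<open>exp ((1 + e) * loglog t)\<close>; the bounds are summable, and on the
complementary event \<open>S n\<close> is at most \<open>sqrt 2 * (1 + 2 * e) * V n * sqrt (loglog (V n))\<close> as long
as \<open>t \<le> V n < \<beta> * t\<close>.

For the lower half, time is cut into blocks during which \<open>V\<close> grows by a large factor \<open>\<beta>\<close>. In
each block the gambler bets that the increment of \<open>S\<close> stays below about
\<open>sqrt 2 * (1 - \<kappa>) * t * sqrt (loglog t)\<close>, \<open>t\<close> being the upper end of the block. The bet is a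
difference of three exponentials, called a tilt: it is positive only if the increment is close to
the value at which the exponents balance, it is at most about \<open>exp (loglog t)\<close>, of order \<open>k\<close>,
and it starts from \<open>1 / 2\<close> and increases at least like a fair bet. Selling such a tilt
multiplies the capital by \<open>1 + c / k\<close> whenever the increment is too small, and leaves it positive
in any case. The product of these factors diverges, so almost surely the increments are large in
infinitely many blocks (\<open>tilt_positive_infinitely_often\<close>). If \<open>S n\<close> were eventually below
\<open>sqrt 2 * (1 - \<kappa>) * V n * sqrt (loglog (V n))\<close>, then together with the upper half for \<open>- X\<close>, which
controls \<open>S\<close> at the beginning of a block, all late increments would be too small
(\<open>block_tilt_eventually_nonpos\<close>).
\<close>

section \<open>Quadratic bounds for the exponential and growth of the iterated logarithm\<close>

text \<open>
Both bounds amount to \<open>ln (1 + y) = y - y\<^sup>2 / 2 + o(y\<^sup>2)\<close>: any \<open>e > 0\<close> absorbs the error term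
near \<open>0\<close>.
\<close>

lemma exp_quadratic_bounds:
  fixes e :: real assumes "e > 0"
  obtains d where "0 < d" "d \<le> 1"
    "\<And>y. \<bar>y\<bar> \<le> d \<Longrightarrow> exp (y - (1 + e) * y\<^sup>2 / 2) \<le> 1 + y"
    "\<And>y. \<bar>y\<bar> \<le> d \<Longrightarrow> 1 + y \<le> exp (y - (1 - e) * y\<^sup>2 / 2)"
proof -
  have "((\<lambda>y::real. (ln (1 + y) - y) / y\<^sup>2) \<longlongrightarrow> - (1/2)) (at 0)"
    unfolding filterlim_at_split by (intro conjI; real_asymp)
  then have "\<forall>\<^sub>F y::real in at 0. dist ((ln (1 + y) - y) / y\<^sup>2) (- (1/2)) < e / 2"
    using tendstoD[of _ "- (1/2) :: real" "at 0" "e / 2"] assms by simp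
  then obtain d0 where d0: "d0 > 0"
    "\<And>y. y \<noteq> 0 \<Longrightarrow> \<bar>y\<bar> < d0 \<Longrightarrow> \<bar>(ln (1 + y) - y) / y\<^sup>2 + 1/2\<bar> < e / 2"
    unfolding eventually_at by (auto simp: dist_real_def)
  define d where "d = min (1/2) (d0 / 2)"
  have bounds: "y - (1 + e) * y\<^sup>2 / 2 \<le> ln (1 + y) \<and> ln (1 + y) \<le> y - (1 - e) * y\<^sup>2 / 2"
    if "\<bar>y\<bar> \<le> d" for y
  proof (cases "y = 0")
    case False
    have "\<bar>y\<bar> < d0" using that d0(1) unfolding d_def by linarith
    from d0(2)[OF False this]
    have "(ln (1 + y) - y) / y\<^sup>2 \<le> -1/2 + e/2" "-1/2 - e/2 \<le> (ln (1 + y) - y) / y\<^sup>2"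
      by linarith+
    then have "ln (1 + y) - y \<le> (-1/2 + e/2) * y\<^sup>2" "(-1/2 - e/2) * y\<^sup>2 \<le> ln (1 + y) - y"
      using False by (simp_all add: pos_divide_le_eq pos_le_divide_eq)
    then show ?thesis by (simp add: field_simps)
  qed simp
  show ?thesis
  proof
    show "0 < d" "d \<le> 1" using d0(1) unfolding d_def by auto
    fix y :: real assume y: "\<bar>y\<bar> \<le> d"
    then have pos: "1 + y > 0" unfolding d_def by linarith
    show "exp (y - (1 + e) * y\<^sup>2 / 2) \<le> 1 + y"
      using bounds[OF y] pos by (metis exp_le_cancel_iff exp_ln)
    show "1 + y \<le> exp (y - (1 - e) * y\<^sup>2 / 2)"
      using bounds[OF y] pos by (metis exp_le_cancel_iff exp_ln)
  qed
qed

definition loglog :: "real \<Rightarrow> real" where "loglog v = ln (ln v)"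

lemma loglog_mono:
  assumes "exp (exp 1) \<le> v" "v \<le> w" shows "loglog v \<le> loglog w"
proof -
  have v0: "0 < v" using assms(1) by (meson exp_gt_zero less_le_trans)
  have "exp 1 \<le> ln v" using assms(1) v0 by (simp add: ln_ge_iff)
  then have "0 < ln v" by (meson exp_gt_zero less_le_trans)
  moreover have "ln v \<le> ln w" using assms v0 by simp
  ultimately show ?thesis unfolding loglog_def by simp
qed

lemma loglog_ge_1: "exp (exp 1) \<le> v \<Longrightarrow> 1 \<le> loglog v"
proof -
  assume a: "exp (exp 1) \<le> v"
  have v0: "0 < v" using a by (meson exp_gt_zero less_le_trans)
  have l: "exp 1 \<le> ln v" using a v0 by (simp add: ln_ge_iff)
  then have "0 < ln v" by (meson exp_gt_zero less_le_trans)
  then show ?thesis using l unfolding loglog_def by (simp add: ln_ge_iff)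
qed

text \<open>
A change of scale by a factor \<open>c\<close> affects \<open>loglog\<close> by at most \<open>c\<^sup>2\<close>. This crude estimate, obtained from
\<open>ln x \<le> x - 1\<close> applied twice, replaces slow variation in all comparisons of nearby scales.
\<close>

lemma loglog_growth:
  assumes v: "exp (exp 1) \<le> v" and vw: "v \<le> w"
  shows "loglog w \<le> loglog v * (w / v)\<^sup>2"
proof -
  have v0: "0 < v" using v by (meson exp_gt_zero less_le_trans)
  have w0: "0 < w" using v0 vw by linarith
  have "exp 1 \<le> ln v" using v v0 by (simp add: ln_ge_iff)
  then have lv: "1 \<le> ln v" using exp_ge_add_one_self[of 1] by linarith
  have lvw: "ln v \<le> ln w" using v0 vw by simp
  have r: "1 \<le> w / v" using v0 vw by simp
  have "loglog w - loglog v = ln (ln w / ln v)"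
    using lv lvw unfolding loglog_def by (simp add: ln_div)
  also have "\<dots> \<le> ln w / ln v - 1" using lv lvw by (intro ln_le_minus_one) simp
  also have "\<dots> = (ln w - ln v) / ln v" using lv by (simp add: field_simps)
  also have "\<dots> \<le> ln w - ln v" using lv lvw by (simp add: pos_divide_le_eq mult_le_cancel_left1)
  also have "\<dots> = ln (w / v)" using v0 w0 by (simp add: ln_div)
  also have "\<dots> \<le> w / v - 1" using v0 w0 by (intro ln_le_minus_one) simp
  finally have 1: "loglog w \<le> loglog v + (w / v - 1)" by linarith
  have L: "1 \<le> loglog v" by (rule loglog_ge_1[OF v])
  have "loglog v + (w / v - 1) \<le> loglog v + loglog v * (w / v - 1)"
    using L r by (simp add: mult_le_cancel_right1)
  also have "\<dots> = loglog v * (w / v)" by (simp add: algebra_simps)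
  also have "\<dots> \<le> loglog v * (w / v)\<^sup>2" using L self_le_power[OF r, of 2] by (intro mult_left_mono) simp_all
  finally show ?thesis using 1 by linarith
qed

lemma div_sqrt_loglog_mono:
  assumes v: "exp (exp 1) \<le> v" and vw: "v \<le> w"
  shows "v / sqrt (loglog v) \<le> w / sqrt (loglog w)"
proof -
  have v0: "0 < v" using v by (meson exp_gt_zero less_le_trans)
  have L: "1 \<le> loglog v" "1 \<le> loglog w" using loglog_ge_1 v vw by auto
  have "sqrt (loglog w) \<le> sqrt (loglog v * (w / v)\<^sup>2)" using loglog_growth[OF assms] by simp
  also have "\<dots> = sqrt (loglog v) * (w / v)" using v0 vw by (simp add: real_sqrt_mult)
  finally show ?thesis using v0 vw L by (simp add: field_simps)
qed

section \<open>Products and tilts of exponentials along a path\<close>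

text \<open>
The exponential of \<open>c\<close> times the total gain, compensated by \<open>e\<close> times half the sum of squares of
the scaled gains. As long as the gains are small, for \<open>e > 1\<close> it behaves like a supermartingale, for \<open>e < 1\<close> like a
submartingale.
\<close>

definition expo :: "real \<Rightarrow> real \<Rightarrow> (nat \<Rightarrow> real) \<Rightarrow> nat \<Rightarrow> real" where
  "expo c e y n = exp (c * (\<Sum>i=1..n. y i) - e * c\<^sup>2 * (\<Sum>i=1..n. (y i)\<^sup>2) / 2)"

lemma expo_0: "expo c e y 0 = 1"
  by (simp add: expo_def)

lemma expo_pos: "0 < expo c e y n"
  by (simp add: expo_def)

lemma expo_Suc:
  "expo c e y (Suc n) = expo c e y n * exp (c * y (Suc n) - e * (c * y (Suc n))\<^sup>2 / 2)"
  unfolding expo_def exp_add[symmetric] by (simp add: algebra_simps power_mult_distrib add_divide_distrib)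

lemma expo_cong: "(\<And>i. 1 \<le> i \<Longrightarrow> i \<le> n \<Longrightarrow> y i = z i) \<Longrightarrow> expo c e y n = expo c e z n"
  unfolding expo_def by (metis (no_types, lifting) atLeastAtMost_iff sum.cong)

lemma expo_const:
  assumes "j \<le> n" "\<And>i. j < i \<Longrightarrow> i \<le> n \<Longrightarrow> y i = 0"
  shows "expo c e y n = expo c e y j"
  using assms
proof (induction n)
  case (Suc n)
  then show ?case by (cases "j = Suc n") (auto simp: expo_Suc)
qed simp

text \<open>
With \<open>u\<close> the total gain and \<open>x\<close> half the sum of squared gains, the first exponential compares
with the two others, whose exponents are scaled by \<open>1 \<plusminus> d\<close>, as follows: the one with \<open>1 + d\<close>
dominates when \<open>u\<close> is well above \<open>2 * x\<close>, the one with \<open>1 - d\<close> when \<open>u\<close> is well below. Up to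
constants, the difference is therefore positive only for \<open>u\<close> near \<open>2 * x\<close>. The error
parameter \<open>d\<^sup>2\<close> is negligible relative to the separation \<open>d\<close> of the scales.
\<close>

definition tilt :: "real \<Rightarrow> (nat \<Rightarrow> real) \<Rightarrow> nat \<Rightarrow> real" where
  "tilt d y n = expo 1 (1 - d\<^sup>2) y n - expo (1 + d) (1 + d\<^sup>2) y n / 4 - expo (1 - d) (1 + d\<^sup>2) y n / 4"

text \<open>
The coefficient of the next gain in the first-order expansion of the tilt.
\<close>

definition tilt_slope :: "real \<Rightarrow> (nat \<Rightarrow> real) \<Rightarrow> nat \<Rightarrow> real" where
  "tilt_slope d y n = expo 1 (1 - d\<^sup>2) y n - (1 + d) * expo (1 + d) (1 + d\<^sup>2) y n / 4
      - (1 - d) * expo (1 - d) (1 + d\<^sup>2) y n / 4"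

lemma tilt_0: "tilt d y 0 = 1 / 2"
  by (simp add: tilt_def expo_0)

lemma tilt_Suc_eq: "y (Suc n) = 0 \<Longrightarrow> tilt d y (Suc n) = tilt d y n"
  by (simp add: tilt_def expo_Suc)

text \<open>
The lower quadratic bound applies to the exponential with a positive sign, the upper one to the
two exponentials with a negative sign, so all three errors have the favourable sign. The gain is
bounded by \<open>\<delta> / 2\<close> because the upper scale \<open>1 + d\<close> may be as large as \<open>2\<close>.
\<close>

lemma tilt_Suc:
  assumes d: "0 < d" "d < 1" and y: "\<bar>y (Suc n)\<bar> \<le> \<delta> / 2"
    and up: "\<And>y. \<bar>y\<bar> \<le> \<delta> \<Longrightarrow> exp (y - (1 + d\<^sup>2) * y\<^sup>2 / 2) \<le> 1 + y"
    and lo: "\<And>y. \<bar>y\<bar> \<le> \<delta> \<Longrightarrow> 1 + y \<le> exp (y - (1 - d\<^sup>2) * y\<^sup>2 / 2)"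
  shows "tilt d y n + tilt_slope d y n * y (Suc n) \<le> tilt d y (Suc n)"
proof -
  have sc: "\<bar>c * y (Suc n)\<bar> \<le> \<delta>" if "0 \<le> c" "c \<le> 2" for c
  proof -
    have "\<bar>c * y (Suc n)\<bar> = c * \<bar>y (Suc n)\<bar>" using that by (simp add: abs_mult)
    also have "\<dots> \<le> 2 * (\<delta> / 2)" by (rule mult_mono) (use that y in auto)
    finally show ?thesis by simp
  qed
  have 1: "expo 1 (1 - d\<^sup>2) y n * (1 + y (Suc n)) \<le> expo 1 (1 - d\<^sup>2) y (Suc n)"
    unfolding expo_Suc using lo[OF sc[of 1]] expo_pos[of 1 "1 - d\<^sup>2" y n] by (intro mult_left_mono) auto
  have 2: "expo c (1 + d\<^sup>2) y (Suc n) \<le> expo c (1 + d\<^sup>2) y n * (1 + c * y (Suc n))"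
    if "0 \<le> c" "c \<le> 2" for c
    unfolding expo_Suc using up[OF sc[OF that]] expo_pos[of c "1 + d\<^sup>2" y n] by (intro mult_left_mono) auto
  show ?thesis using 1 2[of "1 + d"] 2[of "1 - d"] d
    unfolding tilt_def tilt_slope_def
    by (simp add: algebra_simps add_divide_distrib diff_divide_distrib)
qed

text \<open>
Where the tilt is positive, its first exponential dominates a quarter of the second, which forces
\<open>u \<le> (2 + 6 * d) * x + ln 4 / d\<close>. The exponent \<open>u - (1 - d\<^sup>2) * x\<close> is then at most
\<open>(1 + 7 * d) * x\<close> up to a constant.
\<close>

lemma tilt_le:
  assumes d: "0 < d" "d \<le> 1/4" and b: "(\<Sum>i=1..n. (y i)\<^sup>2) / 2 \<le> b"
  shows "tilt d y n \<le> exp (ln 4 / d + (1 + 7 * d) * b)"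
proof -
  define u x where "u = (\<Sum>i=1..n. y i)" and "x = (\<Sum>i=1..n. (y i)\<^sup>2) / 2"
  have x: "0 \<le> x" "x \<le> b" using b unfolding x_def by (auto intro: sum_nonneg)
  have e: "expo c e y n = exp (c * u - e * c\<^sup>2 * x)" for c e
    unfolding expo_def u_def x_def by simp
  define r where "r = (1 + d\<^sup>2) * (1 + d)\<^sup>2 - (1 - d\<^sup>2)"
  have "r \<le> d * (2 + 6 * d)"
  proof -
    have "d * (2 + 6 * d) - r = d\<^sup>2 * (3 - 2 * d - d\<^sup>2)"
      unfolding r_def by (simp add: algebra_simps power2_eq_square)
    moreover have "d * d \<le> 1/4 * (1/4)" using d by (intro mult_mono) auto
    then have "0 \<le> 3 - 2 * d - d\<^sup>2" using d by (simp add: power2_eq_square)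
    ultimately show ?thesis by (metis diff_ge_0_iff_ge mult_nonneg_nonneg zero_le_power2)
  qed
  show ?thesis
  proof (cases "d * u \<le> ln 4 + r * x")
    case True
    have "u \<le> (ln 4 + r * x) / d" using True d by (simp add: pos_le_divide_eq mult.commute)
    also have "\<dots> \<le> ln 4 / d + (2 + 6 * d) * x"
    proof -
      have "r * x \<le> d * (2 + 6 * d) * x" using \<open>r \<le> _\<close> x by (intro mult_right_mono) auto
      then have "r * x / d \<le> (2 + 6 * d) * x" using d by (simp add: pos_divide_le_eq mult_ac)
      then show ?thesis by (simp add: add_divide_distrib)
    qed
    finally have "u - (1 - d\<^sup>2) * x \<le> ln 4 / d + (1 + 6 * d + d\<^sup>2) * x" by (simp add: algebra_simps)
    also have "d\<^sup>2 \<le> d" using d by (simp add: power2_eq_square mult_left_le)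
    then have "ln 4 / d + (1 + 6 * d + d\<^sup>2) * x \<le> ln 4 / d + (1 + 7 * d) * b"
      using x d by (intro add_left_mono mult_mono) auto
    finally have "expo 1 (1 - d\<^sup>2) y n \<le> exp (ln 4 / d + (1 + 7 * d) * b)" by (simp add: e)
    then show ?thesis using expo_pos[of "1 + d" "1 + d\<^sup>2" y n] expo_pos[of "1 - d" "1 + d\<^sup>2" y n]
      unfolding tilt_def by linarith
  next
    case False
    then have "ln 4 + (u - (1 - d\<^sup>2) * x) \<le> (1 + d) * u - (1 + d\<^sup>2) * (1 + d)\<^sup>2 * x"
      unfolding r_def by (simp add: algebra_simps)
    then have "exp (ln 4 + (u - (1 - d\<^sup>2) * x)) \<le> expo (1 + d) (1 + d\<^sup>2) y n" by (simp add: e)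
    then have "4 * expo 1 (1 - d\<^sup>2) y n \<le> expo (1 + d) (1 + d\<^sup>2) y n" by (simp add: e exp_add)
    then have "tilt d y n \<le> 0" using expo_pos[of "1 - d" "1 + d\<^sup>2" y n] unfolding tilt_def by linarith
    then show ?thesis by (meson exp_ge_zero order_trans)
  qed
qed

text \<open>
Below this threshold a quarter of the third exponential already outweighs the first.
\<close>

lemma tilt_nonpos:
  assumes d: "0 < d" "d \<le> 1"
    and le: "(\<Sum>i=1..n. y i) \<le> (2 - 3 * d) * ((\<Sum>i=1..n. (y i)\<^sup>2) / 2) - ln 4 / d"
  shows "tilt d y n \<le> 0"
proof -
  define u x where "u = (\<Sum>i=1..n. y i)" and "x = (\<Sum>i=1..n. (y i)\<^sup>2) / 2"
  have x: "0 \<le> x" unfolding x_def by (auto intro: sum_nonneg)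
  have e: "expo c e y n = exp (c * u - e * c\<^sup>2 * x)" for c e
    unfolding expo_def u_def x_def by simp
  define r where "r = (1 - d\<^sup>2) - (1 + d\<^sup>2) * (1 - d)\<^sup>2"
  have "d * (2 - 3 * d) \<le> r"
  proof -
    have "r - d * (2 - 3 * d) = d\<^sup>2 * (d * (2 - d))"
      unfolding r_def by (simp add: algebra_simps power2_eq_square)
    moreover have "0 \<le> d\<^sup>2 * (d * (2 - d))" using d by simp
    ultimately show ?thesis by linarith
  qed
  have "d * u \<le> d * ((2 - 3 * d) * x - ln 4 / d)"
    using le d unfolding u_def x_def by (intro mult_left_mono) auto
  also have "\<dots> = d * (2 - 3 * d) * x - ln 4" using d by (simp add: field_simps)
  also have "\<dots> \<le> r * x - ln 4" using \<open>_ \<le> r\<close> x by (intro diff_right_mono mult_right_mono) auto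
  finally have "ln 4 + (u - (1 - d\<^sup>2) * x) \<le> (1 - d) * u - (1 + d\<^sup>2) * (1 - d)\<^sup>2 * x"
    unfolding r_def by (simp add: algebra_simps)
  then have "exp (ln 4 + (u - (1 - d\<^sup>2) * x)) \<le> expo (1 - d) (1 + d\<^sup>2) y n" by (simp add: e)
  then have "4 * expo 1 (1 - d\<^sup>2) y n \<le> expo (1 - d) (1 + d\<^sup>2) y n" by (simp add: e exp_add)
  then show ?thesis using expo_pos[of "1 + d" "1 + d\<^sup>2" y n] unfolding tilt_def by linarith
qed

lemma one_plus_sum_le_prod:
  fixes a :: "'a \<Rightarrow> real"
  assumes "finite I" "\<And>i. i \<in> I \<Longrightarrow> 0 \<le> a i"
  shows "1 + sum a I \<le> (\<Prod>i\<in>I. 1 + a i)"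
  using assms
proof (induction I)
  case (insert i I)
  have "1 + sum a (insert i I) \<le> (1 + a i) * (1 + sum a I)"
    using insert sum_nonneg[of I a] by (simp add: algebra_simps)
  also have "\<dots> \<le> (1 + a i) * (\<Prod>i\<in>I. 1 + a i)" using insert by (intro mult_left_mono) auto
  finally show ?case using insert by simp
qed simp

section \<open>Betting against a martingale difference sequence\<close>

text \<open>
The hypotheses that are shared by both halves. They are symmetric under \<open>X \<mapsto> - X\<close>.
\<close>

locale dominated_mds =
  fixes M :: "'a measure" and F :: "nat \<Rightarrow> 'a measure" and X m :: "nat \<Rightarrow> 'a \<Rightarrow> real"
  assumes prob_M: "prob_space M"
    and mds: "martingale_difference_seq M F X"
    and m_meas: "\<And>n. n \<ge> 1 \<Longrightarrow> m n \<in> borel_measurable (F (n - 1))"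
    and X_le: "\<And>n. n \<ge> 1 \<Longrightarrow> AE \<omega> in M. \<bar>X n \<omega>\<bar> \<le> m n \<omega>"
begin

sublocale prob_space M by (rule prob_M)

lemma subalg: "subalgebra M (F n)"
  using mds by (simp add: martingale_difference_seq_def)

lemma X_int: "n \<ge> 1 \<Longrightarrow> integrable M (X n)"
  using mds by (simp add: martingale_difference_seq_def)

lemma space_F [simp]: "space (F n) = space M"
  using subalg by (simp add: subalgebra_def)

lemma F_mono: "f \<in> borel_measurable (F i) \<Longrightarrow> i \<le> n \<Longrightarrow> f \<in> borel_measurable (F n)"
proof -
  assume f: "f \<in> borel_measurable (F i)" and i: "i \<le> n"
  have "sets (F i) \<subseteq> sets (F n)"
    using mds i by (auto simp: martingale_difference_seq_def filtration_def)
  then have "subalgebra (F n) (F i)" by (simp add: subalgebra_def)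
  then show ?thesis using f by (rule measurable_from_subalg)
qed

lemma F_M: "f \<in> borel_measurable (F i) \<Longrightarrow> f \<in> borel_measurable M"
  using subalg by (rule measurable_from_subalg)

lemma X_meas: "1 \<le> i \<Longrightarrow> i \<le> n \<Longrightarrow> X i \<in> borel_measurable (F n)"
  by (rule F_mono[of _ i]) (use mds in \<open>auto simp: martingale_difference_seq_def\<close>)

lemma self_norm_meas: "self_norm X n \<in> borel_measurable (F n)"
proof -
  have [measurable]: "(\<lambda>\<omega>. \<Sum>i=1..n. (X i \<omega>)\<^sup>2) \<in> borel_measurable (F n)"
    by (intro borel_measurable_sum borel_measurable_power X_meas) auto
  show ?thesis unfolding self_norm_def[abs_def] by measurable
qed

text \<open>
The admissible coefficients of bets on \<open>X (Suc n)\<close>. Boundedness is only required almost surely, as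
the domination of \<open>X\<close> by \<open>m\<close> holds only almost surely.
\<close>

definition bounded_at :: "nat \<Rightarrow> ('a \<Rightarrow> real) \<Rightarrow> bool" where
  "bounded_at n g \<longleftrightarrow> g \<in> borel_measurable (F n) \<and> (\<exists>b. AE \<omega> in M. \<bar>g \<omega>\<bar> \<le> b)"

lemma bounded_at_const: "bounded_at n (\<lambda>_. c)"
  unfolding bounded_at_def by auto

lemma bounded_at_add: 
  assumes "bounded_at n f" "bounded_at n g" shows "bounded_at n (\<lambda>\<omega>. f \<omega> + g \<omega>)"
proof -
  obtain a b where "AE \<omega> in M. \<bar>f \<omega>\<bar> \<le> a" "AE \<omega> in M. \<bar>g \<omega>\<bar> \<le> b"
    using assms by (auto simp: bounded_at_def)
  then have "AE \<omega> in M. \<bar>f \<omega> + g \<omega>\<bar> \<le> a + b" by eventually_elim linarith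
  then show ?thesis using assms by (auto simp: bounded_at_def)
qed

lemma bounded_at_mult:
  assumes "bounded_at n f" "bounded_at n g" shows "bounded_at n (\<lambda>\<omega>. f \<omega> * g \<omega>)"
proof -
  obtain a b where "AE \<omega> in M. \<bar>f \<omega>\<bar> \<le> a" "AE \<omega> in M. \<bar>g \<omega>\<bar> \<le> b"
    using assms by (auto simp: bounded_at_def)
  then have "AE \<omega> in M. \<bar>f \<omega> * g \<omega>\<bar> \<le> a * b"
    by eventually_elim (simp add: abs_mult mult_mono')
  then show ?thesis using assms by (auto simp: bounded_at_def)
qed

lemma bounded_at_diff:
  assumes "bounded_at n f" "bounded_at n g" shows "bounded_at n (\<lambda>\<omega>. f \<omega> - g \<omega>)"
  using bounded_at_add[OF assms(1) bounded_at_mult[OF bounded_at_const assms(2), of "-1"]] by simp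

lemma bounded_at_divide_const:
  assumes "bounded_at n f" shows "bounded_at n (\<lambda>\<omega>. f \<omega> / c)"
  using bounded_at_mult[OF assms bounded_at_const[of n "1 / c"]] by simp

lemma bounded_at_sum:
  assumes "\<And>i. i \<in> I \<Longrightarrow> bounded_at n (f i)" shows "bounded_at n (\<lambda>\<omega>. \<Sum>i\<in>I. f i \<omega>)"
  using assms by (induction I rule: infinite_finite_induct) (auto intro: bounded_at_const bounded_at_add)

lemma bounded_at_prod:
  assumes "\<And>i. i \<in> I \<Longrightarrow> bounded_at n (f i)" shows "bounded_at n (\<lambda>\<omega>. \<Prod>i\<in>I. f i \<omega>)"
  using assms by (induction I rule: infinite_finite_induct) (auto intro: bounded_at_const bounded_at_mult)

lemma bounded_at_exp:
  assumes "bounded_at n f" shows "bounded_at n (\<lambda>\<omega>. exp (f \<omega>))"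
proof -
  obtain a where "AE \<omega> in M. \<bar>f \<omega>\<bar> \<le> a" using assms by (auto simp: bounded_at_def)
  then have "AE \<omega> in M. \<bar>exp (f \<omega>)\<bar> \<le> exp a" by eventually_elim (simp add: abs_le_iff)
  moreover have "(\<lambda>\<omega>. exp (f \<omega>)) \<in> borel_measurable (F n)"
  proof -
    have [measurable]: "f \<in> borel_measurable (F n)" using assms by (simp add: bounded_at_def)
    show ?thesis by measurable
  qed
  ultimately show ?thesis unfolding bounded_at_def by blast
qed

lemma bounded_at_gate:
  assumes "bounded_at n f" "Measurable.pred (F n) P"
  shows "bounded_at n (\<lambda>\<omega>. if P \<omega> then f \<omega> else 0)"
proof -
  have [measurable]: "f \<in> borel_measurable (F n)" "Measurable.pred (F n) P"
    using assms by (auto simp: bounded_at_def)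
  obtain a where a: "AE \<omega> in M. \<bar>f \<omega>\<bar> \<le> a" using assms by (auto simp: bounded_at_def)
  have "AE \<omega> in M. \<bar>if P \<omega> then f \<omega> else 0\<bar> \<le> a" using a by eventually_elim auto
  moreover have "(\<lambda>\<omega>. if P \<omega> then f \<omega> else 0) \<in> borel_measurable (F n)" by measurable
  ultimately show ?thesis unfolding bounded_at_def by blast
qed

lemma bounded_at_orthogonal:
  assumes n: "n \<ge> 1" and U: "bounded_at (n - 1) U"
  shows "integrable M (\<lambda>\<omega>. U \<omega> * X n \<omega>)" "(\<integral>\<omega>. U \<omega> * X n \<omega> \<partial>M) = 0"
proof -
  interpret sigma_finite_subalgebra M "F (n - 1)"
    by (rule finite_measure_subalgebra_is_sigma_finite)
       (simp add: finite_measure_subalgebra_def finite_measure_subalgebra_axioms_def finite_measure_axioms subalg)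
  have UF: "U \<in> borel_measurable (F (n - 1))" using U by (simp add: bounded_at_def)
  have UM [measurable]: "U \<in> borel_measurable M" using UF by (rule F_M)
  have XM [measurable]: "X n \<in> borel_measurable M" using X_int[OF n] by simp
  obtain b where b: "AE \<omega> in M. \<bar>U \<omega>\<bar> \<le> b" using U by (auto simp: bounded_at_def)
  show I: "integrable M (\<lambda>\<omega>. U \<omega> * X n \<omega>)"
  proof (rule Bochner_Integration.integrable_bound)
    show "integrable M (\<lambda>\<omega>. b * X n \<omega>)" using X_int[OF n] by simp
    show "AE \<omega> in M. norm (U \<omega> * X n \<omega>) \<le> norm (b * X n \<omega>)"
      using b by eventually_elim (simp add: abs_mult mult_right_mono)
  qed measurable
  have "(\<integral>\<omega>. U \<omega> * X n \<omega> \<partial>M) = (\<integral>\<omega>. U \<omega> * real_cond_exp M (F (n - 1)) (X n) \<omega> \<partial>M)"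
    using real_cond_exp_intg(2)[OF I UF XM] by simp
  also have "\<dots> = (\<integral>\<omega>. 0 \<partial>M)"
  proof (rule integral_cong_AE)
    have "AE \<omega> in M. real_cond_exp M (F (n - 1)) (X n) \<omega> = 0"
      using mds n by (simp add: martingale_difference_seq_def)
    then show "AE \<omega> in M. U \<omega> * real_cond_exp M (F (n - 1)) (X n) \<omega> = 0"
      by eventually_elim simp
  qed (use borel_measurable_cond_exp2 in measurable)
  finally show "(\<integral>\<omega>. U \<omega> * X n \<omega> \<partial>M) = 0" by simp
qed

text \<open>
The capital \<open>1 + (\<Sum>i. U i * X i)\<close> has expectation \<open>1\<close> because every bet is fair, and Markov's
inequality applies to it. Supermartingales enter the later arguments only as pathwise lower bounds
of such a capital.
\<close>

lemma betting_inequality: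
  assumes U: "\<And>i. 1 \<le> i \<Longrightarrow> i \<le> n \<Longrightarrow> bounded_at (i - 1) (U i)"
    and nonneg: "AE \<omega> in M. 0 \<le> 1 + (\<Sum>i=1..n. U i \<omega> * X i \<omega>)"
    and A: "A \<in> sets M" and c: "0 \<le> c"
    and large: "AE \<omega> in M. \<omega> \<in> A \<longrightarrow> c \<le> 1 + (\<Sum>i=1..n. U i \<omega> * X i \<omega>)"
  shows "c * prob A \<le> 1"
proof -
  have int: "integrable M (\<lambda>\<omega>. U i \<omega> * X i \<omega>)" "(\<integral>\<omega>. U i \<omega> * X i \<omega> \<partial>M) = 0"
    if "i \<in> {1..n}" for i
    using bounded_at_orthogonal[of i "U i"] U[of i] that by auto
  have "c * prob A = (\<integral>\<omega>. c * indicator A \<omega> \<partial>M)" using A by simp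
  also have "\<dots> \<le> (\<integral>\<omega>. 1 + (\<Sum>i=1..n. U i \<omega> * X i \<omega>) \<partial>M)"
  proof (rule integral_mono_AE)
    show "integrable M (\<lambda>\<omega>. c * indicator A \<omega>)" using A by (intro integrable_mult_right integrable_real_indicator) (auto simp: less_top[symmetric])
    show "integrable M (\<lambda>\<omega>. 1 + (\<Sum>i=1..n. U i \<omega> * X i \<omega>))"
      using int by (intro Bochner_Integration.integrable_add Bochner_Integration.integrable_sum) simp_all
    show "AE \<omega> in M. c * indicator A \<omega> \<le> 1 + (\<Sum>i=1..n. U i \<omega> * X i \<omega>)"
      using nonneg large by eventually_elim (auto simp: indicator_def)
  qed
  also have "\<dots> = 1 + (\<Sum>i=1..n. \<integral>\<omega>. U i \<omega> * X i \<omega> \<partial>M)"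
    using int by (subst Bochner_Integration.integral_add) (auto simp: prob_space)
  also have "\<dots> = 1" using int by simp
  finally show ?thesis .
qed

text \<open>
Predictable stakes whose gains \<open>s i * X i\<close> stay in the range where the quadratic bounds for the
exponential hold.
\<close>

definition small_stakes :: "real \<Rightarrow> (nat \<Rightarrow> 'a \<Rightarrow> real) \<Rightarrow> bool" where
  "small_stakes \<delta> s \<longleftrightarrow> (\<forall>i\<ge>1. bounded_at (i - 1) (s i) \<and> (AE \<omega> in M. \<bar>s i \<omega> * X i \<omega>\<bar> \<le> \<delta>))"

lemma small_stakes_AE: "small_stakes \<delta> s \<Longrightarrow> AE \<omega> in M. \<forall>i\<ge>1. \<bar>s i \<omega> * X i \<omega>\<bar> \<le> \<delta>"
  unfolding small_stakes_def AE_all_countable by auto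

lemma gain_bounded_at:
  assumes "small_stakes \<delta> s" "1 \<le> i" "i \<le> n"
  shows "bounded_at n (\<lambda>\<omega>. s i \<omega> * X i \<omega>)"
proof -
  have "s i \<in> borel_measurable (F n)"
    using assms F_mono[of "s i" "i - 1" n] by (simp add: small_stakes_def bounded_at_def)
  then show ?thesis
    using assms X_meas[of i n] unfolding small_stakes_def bounded_at_def by auto
qed

lemma expo_bounded_at:
  assumes "small_stakes \<delta> s"
  shows "bounded_at n (\<lambda>\<omega>. expo c e (\<lambda>i. s i \<omega> * X i \<omega>) n)"
  unfolding expo_def power2_eq_square
  by (intro bounded_at_exp bounded_at_diff bounded_at_divide_const bounded_at_mult bounded_at_const
      bounded_at_sum gain_bounded_at[OF assms]) auto

lemma tilt_bounded_at:
  assumes "small_stakes \<delta> s"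
  shows "bounded_at n (\<lambda>\<omega>. tilt d (\<lambda>i. s i \<omega> * X i \<omega>) n)"
  unfolding tilt_def
  by (intro bounded_at_diff bounded_at_divide_const expo_bounded_at[OF assms])

lemma tilt_slope_bounded_at:
  assumes "small_stakes \<delta> s"
  shows "bounded_at n (\<lambda>\<omega>. tilt_slope d (\<lambda>i. s i \<omega> * X i \<omega>) n)"
  unfolding tilt_slope_def
  by (intro bounded_at_diff bounded_at_divide_const bounded_at_mult bounded_at_const expo_bounded_at[OF assms])

text \<open>
Since \<open>exp (y - (1 + e) * y\<^sup>2 / 2) \<le> 1 + y\<close>, the exponential is at most the capital of the gambler
who always bets the fraction \<open>s i\<close> of its current value.
\<close>

lemma exponential_inequality:
  assumes s: "small_stakes \<delta> s"
    and up: "\<And>y. \<bar>y\<bar> \<le> \<delta> \<Longrightarrow> exp (y - (1 + e) * y\<^sup>2 / 2) \<le> 1 + y"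
    and A: "A \<in> sets M" and c: "0 \<le> c"
    and large: "AE \<omega> in M. \<omega> \<in> A \<longrightarrow> c \<le> expo 1 (1 + e) (\<lambda>i. s i \<omega> * X i \<omega>) n"
  shows "c * prob A \<le> 1"
proof -
  define U where "U i \<omega> = expo 1 (1 + e) (\<lambda>i. s i \<omega> * X i \<omega>) (i - 1) * s i \<omega>" for i \<omega>
  have U: "bounded_at (i - 1) (U i)" if "1 \<le> i" for i
    unfolding U_def using that s
    by (intro bounded_at_mult expo_bounded_at[OF s]) (auto simp: small_stakes_def)
  have dom: "AE \<omega> in M. expo 1 (1 + e) (\<lambda>i. s i \<omega> * X i \<omega>) n \<le> 1 + (\<Sum>i=1..n. U i \<omega> * X i \<omega>)"
    using small_stakes_AE[OF s]
  proof eventually_elim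
    case (elim \<omega>)
    show ?case
    proof (induction n)
      case 0
      show ?case by (simp add: expo_0)
    next
      case (Suc n)
      let ?y = "\<lambda>i. s i \<omega> * X i \<omega>"
      have "expo 1 (1 + e) ?y (Suc n) \<le> expo 1 (1 + e) ?y n * (1 + ?y (Suc n))"
        unfolding expo_Suc using up[of "?y (Suc n)"] elim expo_pos[of 1 "1 + e" ?y n]
        by (intro mult_left_mono) auto
      also have "\<dots> = expo 1 (1 + e) ?y n + U (Suc n) \<omega> * X (Suc n) \<omega>"
        by (simp add: U_def algebra_simps)
      finally show ?case using Suc by simp
    qed
  qed
  show ?thesis
  proof (rule betting_inequality[of n U A c])
    show "AE \<omega> in M. 0 \<le> 1 + (\<Sum>i=1..n. U i \<omega> * X i \<omega>)"
      using dom by eventually_elim (meson expo_pos less_imp_le order_trans)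
    show "AE \<omega> in M. \<omega> \<in> A \<longrightarrow> c \<le> 1 + (\<Sum>i=1..n. U i \<omega> * X i \<omega>)"
      using dom large by eventually_elim auto
  qed (use U A c in auto)
qed

text \<open>
Stopping is a special case of choosing stakes: with the stakes set to \<open>0\<close> once the exponential has
reached \<open>a\<close>, the final value is at least \<open>a\<close> exactly when the level was reached at some time. This
turns the inequality at a fixed time into a maximal inequality.
\<close>

lemma exponential_maximal_inequality:
  assumes s: "small_stakes \<delta> s" and \<delta>: "0 \<le> \<delta>"
    and up: "\<And>y. \<bar>y\<bar> \<le> \<delta> \<Longrightarrow> exp (y - (1 + e) * y\<^sup>2 / 2) \<le> 1 + y"
    and a: "0 < a"
  shows "{\<omega> \<in> space M. \<exists>n. a \<le> expo 1 (1 + e) (\<lambda>i. s i \<omega> * X i \<omega>) n} \<in> sets M"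
    and "a * prob {\<omega> \<in> space M. \<exists>n. a \<le> expo 1 (1 + e) (\<lambda>i. s i \<omega> * X i \<omega>) n} \<le> 1"
proof -
  define T where "T n \<omega> = expo 1 (1 + e) (\<lambda>i. s i \<omega> * X i \<omega>) n" for n \<omega>
  have TF: "T n \<in> borel_measurable (F n)" for n
    using expo_bounded_at[OF s, of n 1 "1 + e"] unfolding T_def bounded_at_def by simp
  have TM [measurable]: "T n \<in> borel_measurable M" for n using TF by (rule F_M)
  define A where "A n = {\<omega> \<in> space M. \<exists>j\<le>n. a \<le> T j \<omega>}" for n
  have [measurable]: "A n \<in> sets M" for n unfolding A_def by measurable
  define s' where "s' i \<omega> = (if \<forall>j<i. T j \<omega> < a then s i \<omega> else 0)" for i \<omega>
  have s': "small_stakes \<delta> s'"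
    unfolding small_stakes_def
  proof (intro allI impI conjI)
    fix i :: nat assume i: "1 \<le> i"
    have "Measurable.pred (F (i - 1)) (\<lambda>\<omega>. T j \<omega> < a)" if "j \<in> {..<i}" for j
    proof -
      have [measurable]: "T j \<in> borel_measurable (F (i - 1))" using that by (intro F_mono[OF TF]) auto
      show ?thesis by measurable
    qed
    then have "Measurable.pred (F (i - 1)) (\<lambda>\<omega>. \<forall>j\<in>{..<i}. T j \<omega> < a)"
      by (intro pred_intros_finite) auto
    then have "Measurable.pred (F (i - 1)) (\<lambda>\<omega>. \<forall>j<i. T j \<omega> < a)"
      by (simp only: Ball_def lessThan_iff)
    moreover have "bounded_at (i - 1) (s i)" using s i by (simp add: small_stakes_def)
    ultimately show "bounded_at (i - 1) (s' i)"
      unfolding s'_def by (intro bounded_at_gate)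
    have "AE \<omega> in M. \<bar>s i \<omega> * X i \<omega>\<bar> \<le> \<delta>" using s i by (simp add: small_stakes_def)
    then show "AE \<omega> in M. \<bar>s' i \<omega> * X i \<omega>\<bar> \<le> \<delta>"
      by eventually_elim (use \<delta> in \<open>auto simp: s'_def\<close>)
  qed
  have le: "a * prob (A n) \<le> 1" for n
  proof (rule exponential_inequality[OF s' up])
    have "a \<le> expo 1 (1 + e) (\<lambda>i. s' i \<omega> * X i \<omega>) n" if "\<omega> \<in> A n" for \<omega>
    proof -
      have ex: "\<exists>j. a \<le> T j \<omega>" using that by (auto simp: A_def)
      define j where "j = (LEAST j. a \<le> T j \<omega>)"
      have j: "a \<le> T j \<omega>" unfolding j_def using ex by (rule LeastI_ex)
      have less: "T i \<omega> < a" if "i < j" for i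
        using not_less_Least[of i "\<lambda>j. a \<le> T j \<omega>"] that unfolding j_def by simp
      have jn: "j \<le> n" using that unfolding A_def j_def by (auto intro: Least_le order_trans)
      have "expo 1 (1 + e) (\<lambda>i. s' i \<omega> * X i \<omega>) n = expo 1 (1 + e) (\<lambda>i. s' i \<omega> * X i \<omega>) j"
      proof (rule expo_const[OF jn])
        fix i assume "j < i" "i \<le> n"
        then show "s' i \<omega> * X i \<omega> = 0" using j by (auto simp: s'_def not_less)
      qed
      also have "\<dots> = T j \<omega>"
        unfolding T_def by (rule expo_cong) (use less in \<open>auto simp: s'_def\<close>)
      finally show ?thesis using j by simp
    qed
    then show "AE \<omega> in M. \<omega> \<in> A n \<longrightarrow> a \<le> expo 1 (1 + e) (\<lambda>i. s' i \<omega> * X i \<omega>) n" by simp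
  qed (use a in auto)
  have Un: "{\<omega> \<in> space M. \<exists>n. a \<le> T n \<omega>} = (\<Union>n. A n)" unfolding A_def by auto
  show "{\<omega> \<in> space M. \<exists>n. a \<le> expo 1 (1 + e) (\<lambda>i. s i \<omega> * X i \<omega>) n} \<in> sets M"
    unfolding T_def[symmetric] by measurable
  have "(\<lambda>n. prob (A n)) \<longlonglongrightarrow> prob (\<Union>n. A n)"
    by (rule finite_Lim_measure_incseq) (auto simp: incseq_def A_def intro: order_trans)
  then have "(\<lambda>n. a * prob (A n)) \<longlonglongrightarrow> a * prob (\<Union>n. A n)" by (intro tendsto_intros)
  then have "a * prob (\<Union>n. A n) \<le> 1" by (rule LIMSEQ_le_const2) (use le in auto)
  then show "a * prob {\<omega> \<in> space M. \<exists>n. a \<le> expo 1 (1 + e) (\<lambda>i. s i \<omega> * X i \<omega>) n} \<le> 1"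
    unfolding T_def[symmetric] Un .
qed

end

section \<open>Tilts are positive in infinitely many blocks\<close>

context dominated_mds begin

text \<open>
The factor \<open>B k = 1 + (1 / 2 - tilt) / b k\<close> starts at \<open>1\<close>, stays at least \<open>1 / (2 * b k)\<close>,
and is at least \<open>1 + 1 / (2 * b k)\<close> whenever the \<open>k\<close>-th tilt is nonpositive. As at
most one stake is active at a time, the product of finitely many factors changes in one factor
only, and is therefore dominated by the capital of a single gambler. If the tilts of all blocks
from \<open>k1\<close> on were eventually nonpositive with positive probability, the capital on this event
would exceed a constant times \<open>1 + (\<Sum>k. 1 / (2 * b k))\<close>, which is unbounded.
\<close>

lemma tilt_positive_infinitely_often:
  assumes s: "\<And>k. small_stakes (\<delta> / 2) (s k)"
    and disj: "\<And>k l i \<omega>. s k i \<omega> \<noteq> 0 \<Longrightarrow> s l i \<omega> \<noteq> 0 \<Longrightarrow> k = l"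
    and d: "0 < d" "d < 1"
    and up: "\<And>y. \<bar>y\<bar> \<le> \<delta> \<Longrightarrow> exp (y - (1 + d\<^sup>2) * y\<^sup>2 / 2) \<le> 1 + y"
    and lo: "\<And>y. \<bar>y\<bar> \<le> \<delta> \<Longrightarrow> 1 + y \<le> exp (y - (1 - d\<^sup>2) * y\<^sup>2 / 2)"
    and b: "\<And>k. 0 < b k"
    and tilt_b: "\<And>k n. AE \<omega> in M. tilt d (\<lambda>i. s k i \<omega> * X i \<omega>) n \<le> b k"
    and div: "\<not> summable (\<lambda>k. 1 / b k)"
  shows "AE \<omega> in M. \<exists>\<^sub>\<infinity>k. \<exists>\<^sub>\<infinity>n. 0 < tilt d (\<lambda>i. s k i \<omega> * X i \<omega>) n"
proof -
  define f where "f k n \<omega> = tilt d (\<lambda>i. s k i \<omega> * X i \<omega>) n" for k n \<omega>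
  define g where "g k n \<omega> = tilt_slope d (\<lambda>i. s k i \<omega> * X i \<omega>) n" for k n \<omega>
  have f_meas [measurable]: "f k n \<in> borel_measurable M" for k n
    using tilt_bounded_at[OF s, of n d k] unfolding f_def bounded_at_def by (intro F_M[of _ n]) simp
  define B where "B k n \<omega> = 1 + (1 / 2 - f k n \<omega>) / b k" for k n \<omega>
  have B_bounded: "bounded_at n (B k n)" for k n
    unfolding B_def f_def
    by (intro bounded_at_add bounded_at_diff bounded_at_divide_const bounded_at_const tilt_bounded_at[OF s])
  have B_lower: "AE \<omega> in M. \<forall>k n. 1 / (2 * b k) \<le> B k n \<omega>"
  proof -
    have "1 / (2 * b k) \<le> B k n \<omega>" if "f k n \<omega> \<le> b k" for k n \<omega>
      using that b[of k] unfolding B_def by (simp add: field_simps)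
    moreover have "AE \<omega> in M. \<forall>k n. f k n \<omega> \<le> b k"
      unfolding AE_all_countable f_def using tilt_b by blast
    ultimately show ?thesis by (auto elim: AE_mp[OF _ AE_I2])
  qed
  \<comment> \<open>The derivative of the product with respect to the next \<open>X i\<close>, which moves only the factor of the active block.\<close>
  define U where "U K i \<omega> = (\<Sum>k<K. (\<Prod>j\<in>{..<K} - {k}. B j (i - 1) \<omega>) * (- 1 / b k * g k (i - 1) \<omega> * s k i \<omega>))"
    for K i \<omega>
  have U_bounded: "bounded_at (i - 1) (U K i)" if "1 \<le> i" for K i
    unfolding U_def g_def using that s
    by (intro bounded_at_sum bounded_at_prod bounded_at_mult B_bounded bounded_at_const
        tilt_slope_bounded_at[OF s]) (simp_all add: small_stakes_def)
  have dom: "AE \<omega> in M. \<forall>K n. (\<Prod>k<K. B k n \<omega>) \<le> 1 + (\<Sum>i=1..n. U K i \<omega> * X i \<omega>)"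
  proof -
    have "AE \<omega> in M. \<forall>k. \<forall>i\<ge>1. \<bar>s k i \<omega> * X i \<omega>\<bar> \<le> \<delta> / 2"
      unfolding AE_all_countable using small_stakes_AE[OF s] by (simp add: AE_all_countable)
    then show ?thesis using B_lower
    proof eventually_elim
      case (elim \<omega>)
      have Bpos: "0 < B k n \<omega>" for k n
        using elim(2) b[of k] by (meson divide_pos_pos less_le_trans mult_pos_pos zero_less_numeral zero_less_one)
      have step: "(\<Prod>k<K. B k (Suc n) \<omega>) \<le> (\<Prod>k<K. B k n \<omega>) + U K (Suc n) \<omega> * X (Suc n) \<omega>" for K n
      proof (cases "\<exists>k<K. s k (Suc n) \<omega> \<noteq> 0")
        case False
        then have "B k (Suc n) \<omega> = B k n \<omega>" if "k < K" for k
          using that by (simp add: B_def f_def tilt_Suc_eq)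
        moreover have "U K (Suc n) \<omega> = 0" unfolding U_def using False by (intro sum.neutral) auto
        ultimately show ?thesis by simp
      next
        case True
        then obtain k where k: "k < K" "s k (Suc n) \<omega> \<noteq> 0" by blast
        have other: "s j (Suc n) \<omega> = 0" if "j \<noteq> k" for j using disj[OF k(2)] that by blast
        define P where "P = (\<Prod>j\<in>{..<K} - {k}. B j n \<omega>)"
        have P: "0 \<le> P" unfolding P_def using Bpos by (intro prod_nonneg) (simp add: less_imp_le)
        have "U K (Suc n) \<omega> = P * (- 1 / b k * g k n \<omega> * s k (Suc n) \<omega>)
            + (\<Sum>l\<in>{..<K} - {k}. (\<Prod>j\<in>{..<K} - {l}. B j n \<omega>) * (- 1 / b l * g l n \<omega> * s l (Suc n) \<omega>))"
          unfolding U_def P_def using k(1) by (subst sum.remove[of _ k]) auto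
        also have "(\<Sum>l\<in>{..<K} - {k}. (\<Prod>j\<in>{..<K} - {l}. B j n \<omega>) * (- 1 / b l * g l n \<omega> * s l (Suc n) \<omega>)) = 0"
          using other by (intro sum.neutral) auto
        finally have U: "U K (Suc n) \<omega> = P * (- 1 / b k * g k n \<omega> * s k (Suc n) \<omega>)" by simp
        have "B k (Suc n) \<omega> \<le> B k n \<omega> - g k n \<omega> * (s k (Suc n) \<omega> * X (Suc n) \<omega>) / b k"
        proof -
          have "f k n \<omega> + g k n \<omega> * (s k (Suc n) \<omega> * X (Suc n) \<omega>) \<le> f k (Suc n) \<omega>"
            unfolding f_def g_def using elim(1) by (intro tilt_Suc[OF d _ up lo]) auto
          then have "(f k n \<omega> + g k n \<omega> * (s k (Suc n) \<omega> * X (Suc n) \<omega>)) / b k \<le> f k (Suc n) \<omega> / b k"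
            using b[of k] by (intro divide_right_mono) simp_all
          then show ?thesis unfolding B_def
            by (simp add: add_divide_distrib diff_divide_distrib)
        qed
        then have "P * B k (Suc n) \<omega> \<le> P * (B k n \<omega> - g k n \<omega> * (s k (Suc n) \<omega> * X (Suc n) \<omega>) / b k)"
          using P by (rule mult_left_mono)
        also have "\<dots> = P * B k n \<omega> + U K (Suc n) \<omega> * X (Suc n) \<omega>"
          unfolding U by (simp add: algebra_simps)
        finally have "B k (Suc n) \<omega> * P \<le> B k n \<omega> * P + U K (Suc n) \<omega> * X (Suc n) \<omega>"
          by (simp add: mult.commute)
        moreover have "(\<Prod>j<K. B j n \<omega>) = B k n \<omega> * P"
          unfolding P_def using k(1) by (subst prod.remove[of _ k]) auto
        moreover have "(\<Prod>j<K. B j (Suc n) \<omega>) = B k (Suc n) \<omega> * P"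
        proof -
          have "P = (\<Prod>j\<in>{..<K} - {k}. B j (Suc n) \<omega>)"
            unfolding P_def using other by (intro prod.cong) (auto simp: B_def f_def tilt_Suc_eq)
          then show ?thesis using k(1) by (subst prod.remove[of _ k]) auto
        qed
        ultimately show ?thesis by simp
      qed
      show ?case
      proof (intro allI)
        fix K n
        show "(\<Prod>k<K. B k n \<omega>) \<le> 1 + (\<Sum>i=1..n. U K i \<omega> * X i \<omega>)"
        proof (induction n)
          case 0
          show ?case by (simp add: B_def f_def tilt_0)
        next
          case (Suc n)
          then show ?case using step[of n K] by simp
        qed
      qed
    qed
  qed
  define E where "E k1 = {\<omega> \<in> space M. \<forall>k\<ge>k1. \<exists>N. \<forall>n\<ge>N. f k n \<omega> \<le> 0}" for k1
  have [measurable]: "E k1 \<in> sets M" for k1 unfolding E_def by measurable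
  have "prob (E k1) = 0" for k1
  proof (rule ccontr)
    assume "prob (E k1) \<noteq> 0"
    then have pos: "0 < prob (E k1)" by (simp add: zero_less_measure_iff)
    \<comment> \<open>The blocks before \<open>k1\<close> cost at most a fixed positive factor.\<close>
    define c0 where "c0 = (\<Prod>k<k1. 1 / (2 * b k))"
    have c0: "0 < c0" unfolding c0_def using b by (intro prod_pos) simp
    have bound: "c0 * (1 + (\<Sum>k\<in>{k1..<K}. 1 / (2 * b k))) * prob (E k1) \<le> 1" if K: "k1 \<le> K" for K
    proof -
      define c where "c = c0 * (1 + (\<Sum>k\<in>{k1..<K}. 1 / (2 * b k)))"
      have c: "0 \<le> c" unfolding c_def using c0 b by (intro mult_nonneg_nonneg add_nonneg_nonneg sum_nonneg) (auto simp: less_imp_le)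
      define A where "A N = {\<omega> \<in> space M. \<forall>k\<in>{k1..<K}. \<forall>n\<ge>N. f k n \<omega> \<le> 0}" for N
      have [measurable]: "A N \<in> sets M" for N unfolding A_def by measurable
      have le: "c * prob (A N) \<le> 1" for N
      proof (rule betting_inequality[of N "U K" "A N" c])
        show "AE \<omega> in M. 0 \<le> 1 + (\<Sum>i=1..N. U K i \<omega> * X i \<omega>)"
          using dom B_lower
        proof eventually_elim
          case (elim \<omega>)
          have "0 \<le> (\<Prod>k<K. B k N \<omega>)"
          proof (intro prod_nonneg ballI)
            fix k
            have "0 \<le> 1 / (2 * b k)" using b[of k] by simp
            then show "0 \<le> B k N \<omega>" using elim(2) order_trans by blast
          qed
          then show ?case using elim(1) order_trans by blast
        qed
        show "AE \<omega> in M. \<omega> \<in> A N \<longrightarrow> c \<le> 1 + (\<Sum>i=1..N. U K i \<omega> * X i \<omega>)"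
          using dom B_lower
        proof eventually_elim
          case (elim \<omega>)
          have "c \<le> (\<Prod>k<K. B k N \<omega>)" if A: "\<omega> \<in> A N"
          proof -
            have 1: "c0 \<le> (\<Prod>k<k1. B k N \<omega>)"
              unfolding c0_def using elim(2) b by (intro prod_mono) (auto simp: less_imp_le)
            have "1 + (\<Sum>k\<in>{k1..<K}. 1 / (2 * b k)) \<le> (\<Prod>k\<in>{k1..<K}. 1 + 1 / (2 * b k))"
              using b by (intro one_plus_sum_le_prod) (auto simp: less_imp_le)
            also have "\<dots> \<le> (\<Prod>k\<in>{k1..<K}. B k N \<omega>)"
            proof (intro prod_mono conjI)
              fix k assume "k \<in> {k1..<K}"
              then have "f k N \<omega> \<le> 0" using A by (auto simp: A_def)
              then show "1 + 1 / (2 * b k) \<le> B k N \<omega>" unfolding B_def using b[of k] by (simp add: field_simps mult_le_0_iff)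
              show "0 \<le> 1 + 1 / (2 * b k)" using b[of k] by simp
            qed
            finally have 2: "1 + (\<Sum>k\<in>{k1..<K}. 1 / (2 * b k)) \<le> (\<Prod>k\<in>{k1..<K}. B k N \<omega>)" .
            have "c \<le> (\<Prod>k<k1. B k N \<omega>) * (\<Prod>k\<in>{k1..<K}. B k N \<omega>)"
              unfolding c_def using c0 b
              by (intro mult_mono' 1 2) (auto intro!: add_nonneg_nonneg sum_nonneg simp: less_imp_le)
            also have "\<dots> = (\<Prod>k<K. B k N \<omega>)"
              using prod.union_disjoint[of "{..<k1}" "{k1..<K}" "\<lambda>k. B k N \<omega>"] K
              by (simp add: ivl_disj_un ivl_disj_int)
            finally show ?thesis .
          qed
          then show ?case using elim(1) order_trans by blast
        qed
      qed (use U_bounded c in auto)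
      \<comment> \<open>The sets \<open>A N\<close> increase to the event that the tilts of the blocks \<open>k1..<K\<close> are eventually nonpositive.\<close>
      have "(\<lambda>N. prob (A N)) \<longlonglongrightarrow> prob (\<Union>N. A N)"
        by (rule finite_Lim_measure_incseq) (auto simp: incseq_def A_def)
      then have "(\<lambda>N. c * prob (A N)) \<longlonglongrightarrow> c * prob (\<Union>N. A N)" by (intro tendsto_intros)
      then have "c * prob (\<Union>N. A N) \<le> 1" by (rule LIMSEQ_le_const2) (use le in auto)
      moreover have "E k1 \<subseteq> (\<Union>N. A N)"
      proof
        fix \<omega> assume w: "\<omega> \<in> E k1"
        then have "\<forall>k\<in>{k1..<K}. eventually (\<lambda>n. f k n \<omega> \<le> 0) sequentially"
          by (auto simp: E_def eventually_sequentially)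
        then have "eventually (\<lambda>n. \<forall>k\<in>{k1..<K}. f k n \<omega> \<le> 0) sequentially"
          by (subst eventually_ball_finite_distrib) auto
        then obtain N where "\<forall>n\<ge>N. \<forall>k\<in>{k1..<K}. f k n \<omega> \<le> 0" by (auto simp: eventually_sequentially)
        then have "\<omega> \<in> A N" using w by (auto simp: A_def E_def)
        then show "\<omega> \<in> (\<Union>N. A N)" by blast
      qed
      then have "c * prob (E k1) \<le> c * prob (\<Union>N. A N)"
        using c by (intro mult_left_mono finite_measure_mono) auto
      ultimately show ?thesis unfolding c_def by linarith
    qed
    have "summable (\<lambda>k. 1 / b k)"
    proof (rule summableI_nonneg_bounded)
      fix K
      define R where "R = 2 / (c0 * prob (E k1))"
      have R: "(\<Sum>k\<in>{k1..<K}. 1 / b k) \<le> R"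
      proof (cases "k1 \<le> K")
        case True
        have eq: "(\<Sum>k\<in>{k1..<K}. 1 / b k) = 2 * (\<Sum>k\<in>{k1..<K}. 1 / (2 * b k))" by (simp add: sum_distrib_left)
        have "(\<Sum>k\<in>{k1..<K}. 1 / (2 * b k)) * (c0 * prob (E k1)) \<le> 1"
          using bound[OF True] mult_pos_pos[OF c0 pos] by (simp add: algebra_simps)
        then show ?thesis unfolding eq R_def using mult_pos_pos[OF c0 pos] by (simp add: field_simps)
      next
        case False
        then show ?thesis unfolding R_def using mult_pos_pos[OF c0 pos] by simp
      qed
      have "(\<Sum>k<K. 1 / b k) \<le> (\<Sum>k\<in>{..<k1} \<union> {k1..<K}. 1 / b k)"
        using b by (intro sum_mono2) (auto simp: less_imp_le)
      also have "\<dots> = (\<Sum>k<k1. 1 / b k) + (\<Sum>k\<in>{k1..<K}. 1 / b k)"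
        by (intro sum.union_disjoint) auto
      finally show "(\<Sum>k<K. 1 / b k) \<le> (\<Sum>k<k1. 1 / b k) + R" using R by linarith
    qed (use b in \<open>simp add: less_imp_le\<close>)
    with div show False by contradiction
  qed
  then have "AE \<omega> in M. \<omega> \<notin> E k1" for k1
    by (intro AE_not_in) (auto simp: null_sets_def emeasure_eq_measure)
  then have "AE \<omega> in M. \<forall>k1. \<omega> \<notin> E k1" unfolding AE_all_countable by blast
  then show ?thesis
    using AE_space
  proof eventually_elim
    case (elim \<omega>)
    then show ?case
      unfolding INFM_nat_le f_def[symmetric] E_def by (auto simp: not_le)
  qed
qed

end

section \<open>Regular paths and geometric levels\<close>

text \<open>
The pathwise content of the hypotheses. Everything in this section is deterministic.
\<close>

definition regular_path :: "(nat \<Rightarrow> 'a \<Rightarrow> real) \<Rightarrow> (nat \<Rightarrow> 'a \<Rightarrow> real) \<Rightarrow> 'a \<Rightarrow> bool" where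
  "regular_path X m \<omega> \<longleftrightarrow> (\<forall>n\<ge>1. \<bar>X n \<omega>\<bar> \<le> m n \<omega>)
     \<and> filterlim (\<lambda>n. self_norm X n \<omega>) at_top sequentially
     \<and> (\<lambda>n. m n \<omega> / (self_norm X n \<omega> * ln (ln (self_norm X n \<omega>)) powr (- 1 / 2))) \<longlonglongrightarrow> 0"

lemma self_norm_square: "(self_norm X n \<omega>)\<^sup>2 = (\<Sum>i=1..n. (X i \<omega>)\<^sup>2)"
  unfolding self_norm_def by (simp add: sum_nonneg)

lemma self_norm_nonneg: "0 \<le> self_norm X n \<omega>"
  unfolding self_norm_def by (simp add: sum_nonneg)

lemma self_norm_mono: "i \<le> n \<Longrightarrow> self_norm X i \<omega> \<le> self_norm X n \<omega>"
  unfolding self_norm_def by (intro real_sqrt_le_mono sum_mono2) auto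

lemma regular_path_small_increments:
  assumes "regular_path X m \<omega>" "0 < \<eta>"
  shows "\<forall>\<^sub>F n in sequentially. exp (exp 1) \<le> self_norm X n \<omega>
    \<and> m n \<omega> \<le> \<eta> * (self_norm X n \<omega> / sqrt (loglog (self_norm X n \<omega>)))"
proof -
  have "\<forall>\<^sub>F n in sequentially. exp (exp 1) \<le> self_norm X n \<omega>"
    using assms(1) unfolding regular_path_def filterlim_at_top by blast
  moreover have "\<forall>\<^sub>F n in sequentially.
      dist (m n \<omega> / (self_norm X n \<omega> * ln (ln (self_norm X n \<omega>)) powr (- 1 / 2))) 0 < \<eta>"
    using assms unfolding regular_path_def by (intro tendstoD) auto
  ultimately show ?thesis
  proof eventually_elim
    case (elim n)
    define v where "v = self_norm X n \<omega>"
    have v: "exp (exp 1) \<le> v" using elim(1) by (simp add: v_def)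
    have v0: "0 < v" using v by (meson exp_gt_zero less_le_trans)
    have L: "1 \<le> loglog v" by (rule loglog_ge_1[OF v])
    have eq: "v * ln (ln v) powr (- 1 / 2) = v / sqrt (loglog v)"
      using L by (simp add: loglog_def powr_minus_divide powr_half_sqrt)
    have "m n \<omega> / (v / sqrt (loglog v)) < \<eta>"
      using elim(2)[folded v_def, unfolded eq dist_real_def] by linarith
    moreover have "0 < v / sqrt (loglog v)" using v0 L by simp
    ultimately have "m n \<omega> \<le> \<eta> * (v / sqrt (loglog v))"
      by (metis less_imp_le pos_divide_less_eq)
    then show ?case using v by (simp add: v_def)
  qed
qed

text \<open>
From \<open>\<bar>X n\<bar> \<le> m n = o(V n)\<close> and \<open>V n \<le> V (n - 1) + \<bar>X n\<bar>\<close>. It bounds by how much \<open>V\<close> can jump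
over a level.
\<close>

lemma regular_path_steps:
  assumes r: "regular_path X m \<omega>" and i: "0 < \<iota>"
  shows "\<forall>\<^sub>F n in sequentially. self_norm X n \<omega> \<le> (1 + \<iota>) * self_norm X (n - 1) \<omega>"
proof -
  define \<eta> where "\<eta> = \<iota> / (1 + \<iota>)"
  have \<eta>: "0 < \<eta>" using i by (simp add: \<eta>_def)
  show ?thesis
    using regular_path_small_increments[OF r \<eta>] eventually_ge_at_top[of 1]
  proof eventually_elim
    case (elim n)
    define v where "v = self_norm X n \<omega>"
    obtain k where k: "n = Suc k" using elim(2) by (cases n) auto
    have v: "exp (exp 1) \<le> v" using elim(1) by (simp add: v_def)
    have v0: "0 < v" using v by (meson exp_gt_zero less_le_trans)
    have L: "1 \<le> loglog v" by (rule loglog_ge_1[OF v])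
    have "v / sqrt (loglog v) \<le> v" using L v0 by (simp add: divide_le_eq mult_le_cancel_left1)
    then have "m n \<omega> \<le> \<eta> * v" using elim(1) \<eta> mult_left_mono[of "v / sqrt (loglog v)" v \<eta>]
      by (simp add: v_def)
    then have x: "\<bar>X n \<omega>\<bar> \<le> \<eta> * v" using r elim(2) unfolding regular_path_def by force
    have "v = sqrt ((self_norm X k \<omega>)\<^sup>2 + (X n \<omega>)\<^sup>2)"
      unfolding v_def self_norm_square k by (simp add: self_norm_def)
    also have "\<dots> \<le> \<bar>self_norm X k \<omega>\<bar> + \<bar>X n \<omega>\<bar>" by (rule sqrt_sum_squares_le_sum_abs)
    finally have "v \<le> self_norm X k \<omega> + \<eta> * v" using x self_norm_nonneg[of X k \<omega>] by linarith
    then have "(1 + \<iota>) * (v * (1 - \<eta>)) \<le> (1 + \<iota>) * self_norm X k \<omega>"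
      using i by (intro mult_left_mono) (simp_all add: algebra_simps)
    moreover have "(1 + \<iota>) * (v * (1 - \<eta>)) = v" using i by (simp add: \<eta>_def field_simps)
    ultimately have "v \<le> (1 + \<iota>) * self_norm X k \<omega>" by linarith
    then show ?case by (simp add: v_def k)
  qed
qed

text \<open>
The natural stake at scale \<open>t\<close> is \<open>sqrt (loglog t) / t\<close>. Late indices are handled by monotonicity
of \<open>v / sqrt (loglog v)\<close>; the finitely many early ones because the stake tends to \<open>0\<close>. Hence stakes
that are withdrawn when they are too large for \<open>m i\<close> are in fact never withdrawn before \<open>V\<close>
passes \<open>2 * t\<close>, once \<open>t\<close> is large.
\<close>

lemma regular_path_stakes_small:
  assumes r: "regular_path X m \<omega>" and \<delta>: "0 < \<delta>"
  shows "\<forall>\<^sub>F t in at_top. \<forall>i\<ge>1. self_norm X i \<omega> \<le> 2 * t \<longrightarrow> sqrt (loglog t) / t * m i \<omega> \<le> \<delta>"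
proof -
  obtain N where N: "\<And>i. i \<ge> N \<Longrightarrow> exp (exp 1) \<le> self_norm X i \<omega>
    \<and> m i \<omega> \<le> \<delta> / 2 * (self_norm X i \<omega> / sqrt (loglog (self_norm X i \<omega>)))"
    using regular_path_small_increments[OF r, of "\<delta> / 2"] \<delta> by (auto simp: eventually_sequentially)
  have lim: "((\<lambda>t. sqrt (loglog t) / t) \<longlongrightarrow> 0) at_top"
    unfolding loglog_def by real_asymp
  have "\<forall>\<^sub>F t in at_top. sqrt (loglog t) / t * m i \<omega> < \<delta>" for i
  proof -
    have "((\<lambda>t. sqrt (loglog t) / t * m i \<omega>) \<longlongrightarrow> 0 * m i \<omega>) at_top" by (intro tendsto_intros lim)
    then show ?thesis using \<delta> by (intro order_tendstoD(2)) auto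
  qed
  then have "\<forall>\<^sub>F t in at_top. \<forall>i\<in>{..<N}. sqrt (loglog t) / t * m i \<omega> < \<delta>"
    by (intro eventually_ball_finite) auto
  then show ?thesis using eventually_ge_at_top[of "exp (exp 1)"]
  proof eventually_elim
    case (elim t)
    have t0: "0 < t" using elim(2) by (meson exp_gt_zero less_le_trans)
    have Lt: "1 \<le> loglog t" by (rule loglog_ge_1[OF elim(2)])
    show ?case
    proof (intro allI impI)
      fix i :: nat assume i: "1 \<le> i" "self_norm X i \<omega> \<le> 2 * t"
      show "sqrt (loglog t) / t * m i \<omega> \<le> \<delta>"
      proof (cases "i < N")
        case True
        then show ?thesis using elim(1) by force
      next
        case False
        define v where "v = self_norm X i \<omega>"
        have v: "exp (exp 1) \<le> v" "m i \<omega> \<le> \<delta> / 2 * (v / sqrt (loglog v))"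
          using N[of i] False by (auto simp: v_def)
        have "loglog t \<le> loglog (2 * t)" using elim(2) t0 by (intro loglog_mono) auto
        then have "2 * t / sqrt (loglog (2 * t)) \<le> 2 * t / sqrt (loglog t)"
          using t0 Lt by (intro divide_left_mono mult_pos_pos) auto
        moreover have "v / sqrt (loglog v) \<le> 2 * t / sqrt (loglog (2 * t))"
          using div_sqrt_loglog_mono[OF v(1), of "2 * t"] i(2) by (simp add: v_def)
        ultimately have "v / sqrt (loglog v) \<le> 2 * t / sqrt (loglog t)" by linarith
        then have "\<delta> / 2 * (v / sqrt (loglog v)) \<le> \<delta> / 2 * (2 * t / sqrt (loglog t))"
          using \<delta> by (intro mult_left_mono) auto
        then have "m i \<omega> \<le> \<delta> * (t / sqrt (loglog t))" using v(2) by simp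
        then have "sqrt (loglog t) / t * m i \<omega> \<le> sqrt (loglog t) / t * (\<delta> * (t / sqrt (loglog t)))"
          using t0 Lt by (intro mult_left_mono) auto
        also have "\<dots> = \<delta>" using t0 Lt by simp
        finally show ?thesis .
      qed
    qed
  qed
qed

text \<open>
The factor \<open>exp (exp 1)\<close> ensures \<open>loglog \<ge> 1\<close> at every level, including the first.
\<close>

definition level :: "real \<Rightarrow> nat \<Rightarrow> real" where "level \<beta> k = exp (exp 1) * \<beta> ^ k"

lemma level_ge: "1 \<le> \<beta> \<Longrightarrow> exp (exp 1) \<le> level \<beta> k"
  unfolding level_def by (simp add: mult_le_cancel_left1)

lemma level_Suc: "level \<beta> (Suc k) = \<beta> * level \<beta> k"
  by (simp add: level_def)

lemma exp_loglog_level: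
  assumes "1 \<le> \<beta>" shows "exp (loglog (level \<beta> k)) = exp 1 + real k * ln \<beta>"
proof -
  have "ln (level \<beta> k) = exp 1 + real k * ln \<beta>"
    unfolding level_def using assms by (simp add: ln_mult ln_realpow)
  moreover have "0 < exp 1 + real k * ln \<beta>" using assms by (simp add: add_pos_nonneg)
  ultimately show ?thesis unfolding loglog_def by simp
qed

lemma filterlim_level: "1 < \<beta> \<Longrightarrow> filterlim (level \<beta>) at_top sequentially"
  unfolding level_def[abs_def]
  by (intro filterlim_tendsto_pos_mult_at_top[OF tendsto_const] filterlim_realpow_sequentially_gt1
      filterlim_at_infinity_imp_filterlim_at_top) (auto intro!: always_eventually)

lemma level_mono: "1 \<le> \<beta> \<Longrightarrow> i \<le> k \<Longrightarrow> level \<beta> i \<le> level \<beta> k"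
  unfolding level_def by (intro mult_left_mono power_increasing) auto

lemma level_cover:
  assumes "1 < \<beta>" "level \<beta> K \<le> v"
  obtains k where "K \<le> k" "level \<beta> k \<le> v" "v < level \<beta> (Suc k)"
proof -
  have "\<forall>\<^sub>F k in sequentially. v < level \<beta> k"
    using filterlim_level[OF assms(1)] by (simp add: filterlim_at_top_dense)
  then have ex: "\<exists>k. v < level \<beta> k" by (auto simp: eventually_sequentially)
  define j where "j = (LEAST k. v < level \<beta> k)"
  have j: "v < level \<beta> j" unfolding j_def using ex by (rule LeastI_ex)
  have "K < j" using j assms level_mono[of \<beta> j K] by (meson le_less_trans less_imp_le not_less less_irrefl)
  moreover have "\<not> v < level \<beta> (j - 1)"
    using \<open>K < j\<close> not_less_Least[of "j - 1" "\<lambda>k. v < level \<beta> k"] unfolding j_def by simp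
  ultimately show ?thesis using that[of "j - 1"] j by (cases j) auto
qed

section \<open>The upper half\<close>

context dominated_mds begin

text \<open>
A constant stake becomes small in the required sense when it is withdrawn at those times at which
the predictable bound \<open>m i\<close> is too large.
\<close>

lemma gated_small_stakes:
  assumes "0 \<le> l" "0 \<le> \<delta>" and P: "\<And>i. 1 \<le> i \<Longrightarrow> Measurable.pred (F (i - 1)) (P i)"
  shows "small_stakes \<delta> (\<lambda>i \<omega>. if P i \<omega> \<and> l * m i \<omega> \<le> \<delta> then l else 0)"
  unfolding small_stakes_def
proof (intro allI impI conjI)
  fix i :: nat assume i: "1 \<le> i"
  have [measurable]: "m i \<in> borel_measurable (F (i - 1))" "Measurable.pred (F (i - 1)) (P i)"
    using m_meas[OF i] P[OF i] by auto
  have "Measurable.pred (F (i - 1)) (\<lambda>\<omega>. P i \<omega> \<and> l * m i \<omega> \<le> \<delta>)" by measurable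
  then show "bounded_at (i - 1) (\<lambda>\<omega>. if P i \<omega> \<and> l * m i \<omega> \<le> \<delta> then l else 0)"
    by (intro bounded_at_gate bounded_at_const)
  show "AE \<omega> in M. \<bar>(if P i \<omega> \<and> l * m i \<omega> \<le> \<delta> then l else 0) * X i \<omega>\<bar> \<le> \<delta>"
    using X_le[OF i]
  proof eventually_elim
    case (elim \<omega>)
    then have "l * \<bar>X i \<omega>\<bar> \<le> l * m i \<omega>" using assms(1) by (rule mult_left_mono)
    then show ?case using assms by (auto simp: abs_mult)
  qed
qed

text \<open>
For \<open>t \<le> V n < \<beta> * t\<close> the exponential bound \<open>l * S - (1 + e) * l\<^sup>2 * V\<^sup>2 / 2 < (1 + e) * loglog t\<close> with
\<open>l = sqrt (2 * loglog t) / t\<close> gives \<open>l * S \<le> (1 + e) * (1 + \<beta>\<^sup>2) * loglog t\<close>. The choice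
\<open>\<beta>\<^sup>2 = 1 + e\<close> makes this at most \<open>2 * (1 + 2 * e) * loglog t\<close>, as \<open>e \<le> 1\<close>.
\<close>

lemma upper_half:
  assumes regular: "AE \<omega> in M. regular_path X m \<omega>" and e: "0 < e" "e \<le> 1"
  shows "AE \<omega> in M. \<forall>\<^sub>F n in sequentially.
    partial_sum X n \<omega> \<le> sqrt 2 * (1 + 2 * e) * (self_norm X n \<omega> * sqrt (loglog (self_norm X n \<omega>)))"
proof -
  obtain \<delta> where \<delta>: "0 < \<delta>" "\<delta> \<le> 1"
    and up: "\<And>y. \<bar>y\<bar> \<le> \<delta> \<Longrightarrow> exp (y - (1 + e) * y\<^sup>2 / 2) \<le> 1 + y"
    using exp_quadratic_bounds[OF e(1)] by metis
  define \<beta> where "\<beta> = sqrt (1 + e)"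
  have \<beta>: "1 < \<beta>" "\<beta>\<^sup>2 = 1 + e" using e by (simp_all add: \<beta>_def)
  have \<beta>2: "\<beta> \<le> 2"
    using real_sqrt_le_mono[of "1 + e" "2\<^sup>2"] e by (simp add: \<beta>_def)
  define t where "t = level \<beta>"
  define L where "L k = loglog (t k)" for k
  have t: "exp (exp 1) \<le> t k" for k using level_ge[of \<beta> k] \<beta> by (simp add: t_def)
  have t0: "0 < t k" for k using t[of k] by (meson exp_gt_zero less_le_trans)
  have L: "1 \<le> L k" for k unfolding L_def by (rule loglog_ge_1[OF t])
  define l where "l k = sqrt (2 * L k) / t k" for k
  have l: "0 < l k" for k using L[of k] t0[of k] by (simp add: l_def)
  define s where "s k i \<omega> = (if True \<and> l k * m i \<omega> \<le> \<delta> then l k else 0)" for k i \<omega>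
  have s: "small_stakes \<delta> (s k)" for k
    unfolding s_def using l[of k] \<delta> by (intro gated_small_stakes) auto
  define A where "A k = {\<omega> \<in> space M. \<exists>n. exp ((1 + e) * L k) \<le> expo 1 (1 + e) (\<lambda>i. s k i \<omega> * X i \<omega>) n}" for k
  have A: "A k \<in> sets M" "exp ((1 + e) * L k) * prob (A k) \<le> 1" for k
    using exponential_maximal_inequality[OF s _ up, of "exp ((1 + e) * L k)" k] \<delta>
    by (simp_all add: A_def)
  have PA: "prob (A k) \<le> (ln \<beta>) powr - (1 + e) * real k powr - (1 + e)" if "1 \<le> k" for k
  proof -
    have lb: "0 < ln \<beta>" using \<beta> by simp
    have "(real k * ln \<beta>) powr (1 + e) \<le> (exp (L k)) powr (1 + e)"
      unfolding L_def t_def using exp_loglog_level[of \<beta> k] \<beta> e by (intro powr_mono2) auto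
    also have "\<dots> = exp ((1 + e) * L k)" by (simp add: powr_def)
    finally have "(real k * ln \<beta>) powr (1 + e) * prob (A k) \<le> 1"
      using A(2)[of k] by (meson measure_nonneg mult_right_mono order_trans)
    then have "prob (A k) \<le> 1 / (real k * ln \<beta>) powr (1 + e)"
      using that lb by (simp add: pos_le_divide_eq mult.commute)
    also have "\<dots> = (ln \<beta>) powr - (1 + e) * real k powr - (1 + e)"
      unfolding powr_minus using lb by (simp add: powr_mult divide_inverse mult.commute)
    finally show ?thesis .
  qed
  have "summable (\<lambda>k. prob (A k))"
  proof (rule summable_comparison_test_ev)
    show "summable (\<lambda>k. (ln \<beta>) powr - (1 + e) * real k powr - (1 + e))"
      using e by (intro summable_mult) (simp add: summable_real_powr_iff)
    show "\<forall>\<^sub>F k in sequentially. norm (prob (A k)) \<le> (ln \<beta>) powr - (1 + e) * real k powr - (1 + e)"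
      using eventually_ge_at_top[of 1] by eventually_elim (use PA in simp)
  qed
  then have "AE \<omega> in M. \<forall>\<^sub>F k in sequentially. \<omega> \<in> space M - A k"
    using A by (intro borel_cantelli_AE1) (auto simp: less_top[symmetric])
  then show ?thesis using regular
  proof eventually_elim
    case (elim \<omega>)
    have "\<forall>\<^sub>F k in sequentially. \<forall>i\<ge>1. self_norm X i \<omega> \<le> 2 * t k \<longrightarrow> sqrt (loglog (t k)) / t k * m i \<omega> \<le> \<delta> / sqrt 2"
      unfolding t_def
      using eventually_compose_filterlim[OF regular_path_stakes_small[OF elim(2), of "\<delta> / sqrt 2"] filterlim_level[OF \<beta>(1)]] \<delta>
      by simp
    then have "\<forall>\<^sub>F k in sequentially. \<omega> \<in> space M - A k \<and>
        (\<forall>i\<ge>1. self_norm X i \<omega> \<le> 2 * t k \<longrightarrow> sqrt (loglog (t k)) / t k * m i \<omega> \<le> \<delta> / sqrt 2)"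
      using elim(1) by eventually_elim blast
    then obtain K where K: "\<And>k. K \<le> k \<Longrightarrow> \<omega> \<in> space M - A k"
      "\<And>k i. K \<le> k \<Longrightarrow> 1 \<le> i \<Longrightarrow> self_norm X i \<omega> \<le> 2 * t k \<Longrightarrow> sqrt (loglog (t k)) / t k * m i \<omega> \<le> \<delta> / sqrt 2"
      unfolding eventually_sequentially by blast
    have "\<forall>\<^sub>F n in sequentially. t K \<le> self_norm X n \<omega>"
      using elim(2) unfolding regular_path_def filterlim_at_top by blast
    then show ?case
    proof eventually_elim
      case (elim n)
      define V where "V = self_norm X n \<omega>"
      define S where "S = partial_sum X n \<omega>"
      obtain k where k: "K \<le> k" "t k \<le> V" "V < t (Suc k)"
        using level_cover[OF \<beta>(1), of K V] elim unfolding t_def V_def by metis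
      have Vt: "V \<le> \<beta> * t k" using k(3) by (simp add: t_def level_Suc)
      have V0: "0 \<le> V" using k(2) t0[of k] by linarith
      have sl: "s k i \<omega> = l k" if "1 \<le> i" "i \<le> n" for i
      proof -
        have "self_norm X i \<omega> \<le> \<beta> * t k" using self_norm_mono[OF that(2), of X \<omega>] Vt by (simp add: V_def)
        also have "\<dots> \<le> 2 * t k" using \<beta>2 t0[of k] by (intro mult_right_mono) auto
        finally have "sqrt (loglog (t k)) / t k * m i \<omega> \<le> \<delta> / sqrt 2" using K(2) k(1) that by blast
        then have "sqrt 2 * (sqrt (loglog (t k)) / t k * m i \<omega>) \<le> \<delta>" by (simp add: pos_le_divide_eq mult.commute)
        then have "l k * m i \<omega> \<le> \<delta>" by (simp add: l_def L_def real_sqrt_mult mult_ac)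
        then show ?thesis by (simp add: s_def)
      qed
      have sum1: "(\<Sum>i=1..n. s k i \<omega> * X i \<omega>) = l k * S"
        unfolding S_def partial_sum_def sum_distrib_left by (rule sum.cong) (auto simp: sl)
      have sum2: "(\<Sum>i=1..n. (s k i \<omega> * X i \<omega>)\<^sup>2) = (l k)\<^sup>2 * V\<^sup>2"
        unfolding V_def self_norm_square sum_distrib_left by (rule sum.cong) (auto simp: sl power_mult_distrib)
      have "\<omega> \<in> space M - A k" using K(1) k(1) by blast
      then have "expo 1 (1 + e) (\<lambda>i. s k i \<omega> * X i \<omega>) n < exp ((1 + e) * L k)"
        unfolding A_def by (auto simp: not_le)
      then have *: "l k * S - (1 + e) * ((l k)\<^sup>2 * V\<^sup>2) / 2 < (1 + e) * L k"
        unfolding expo_def sum1 sum2 by simp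
      have "(l k)\<^sup>2 * V\<^sup>2 \<le> (l k)\<^sup>2 * (\<beta> * t k)\<^sup>2" using Vt V0 by (intro mult_left_mono power_mono) auto
      also have "\<dots> = 2 * L k * (1 + e)"
        using t0[of k] L[of k] \<beta>(2) by (simp add: l_def power_divide power_mult_distrib)
      finally have "(1 + e) * ((l k)\<^sup>2 * V\<^sup>2) \<le> (1 + e) * (2 * L k * (1 + e))"
        using e by (intro mult_left_mono) auto
      moreover have "(1 + e) * L k + (1 + e) * (2 * L k * (1 + e)) / 2 = ((1 + e) * (2 + e)) * L k"
        by (simp add: field_simps)
      ultimately have "l k * S \<le> ((1 + e) * (2 + e)) * L k" using * by linarith
      also have "\<dots> \<le> (2 * (1 + 2 * e)) * L k"
      proof -
        have "e * e \<le> e" using e by (simp add: mult_left_le)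
        then have "(1 + e) * (2 + e) \<le> 2 * (1 + 2 * e)" by (simp add: algebra_simps)
        then show ?thesis using L[of k] by (intro mult_right_mono) auto
      qed
      also have "\<dots> = l k * (sqrt 2 * (1 + 2 * e) * (t k * sqrt (L k)))"
      proof -
        have "l k * t k = sqrt 2 * sqrt (L k)" using t0[of k] by (simp add: l_def real_sqrt_mult)
        have "l k * (sqrt 2 * (1 + 2 * e) * (t k * sqrt (L k))) = (l k * t k) * (sqrt 2 * (1 + 2 * e) * sqrt (L k))"
          by (simp only: mult_ac)
        also have "\<dots> = (sqrt 2 * sqrt 2) * (1 + 2 * e) * (sqrt (L k) * sqrt (L k))"
          unfolding \<open>l k * t k = _\<close> by (simp only: mult_ac)
        finally show ?thesis using L[of k] by simp
      qed
      finally have "S \<le> sqrt 2 * (1 + 2 * e) * (t k * sqrt (L k))"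
        using l[of k] by simp
      also have "\<dots> \<le> sqrt 2 * (1 + 2 * e) * (V * sqrt (loglog V))"
      proof -
        have "L k \<le> loglog V" unfolding L_def using t k(2) by (intro loglog_mono)
        then have "t k * sqrt (L k) \<le> V * sqrt (loglog V)"
          using k(2) t0[of k] L[of k] by (intro mult_mono) auto
        then show ?thesis using e by (intro mult_left_mono) auto
      qed
      finally show ?case by (simp add: S_def V_def)
    qed
  qed
qed

end

section \<open>The lower half\<close>

text \<open>
By \<open>tilt_le\<close>, the divisor \<open>1 + 7 * d\<close> is exactly what makes the tilt of block \<open>k\<close> bounded by a constant
multiple of \<open>exp (loglog t)\<close>, where \<open>t\<close> is the upper end of the block. This is linear in \<open>k\<close>, so that the
reciprocals have a divergent sum.
\<close>

definition block_size :: "real \<Rightarrow> real \<Rightarrow> nat \<Rightarrow> real" where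
  "block_size d \<beta> k =
     sqrt (2 * loglog (level \<beta> (Suc k)) / (1 + 7 * d)) / level \<beta> (Suc k)"

text \<open>
Active from the first time at which \<open>V\<close> reaches the lower end of the block until the first time
it reaches the upper end, except when \<open>m i\<close> is too large. The condition refers to \<open>V (i - 1)\<close>, which makes the stake predictable.
\<close>

definition block_stake ::
  "(nat \<Rightarrow> 'a \<Rightarrow> real) \<Rightarrow> (nat \<Rightarrow> 'a \<Rightarrow> real) \<Rightarrow> real \<Rightarrow> real \<Rightarrow> real \<Rightarrow> nat \<Rightarrow> nat \<Rightarrow> 'a \<Rightarrow> real" where
  "block_stake X m \<eta> d \<beta> k i \<omega> =
     (if (level \<beta> k \<le> self_norm X (i - 1) \<omega> \<and> self_norm X (i - 1) \<omega> < level \<beta> (Suc k))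
         \<and> block_size d \<beta> k * m i \<omega> \<le> \<eta> then block_size d \<beta> k else 0)"

lemma block_size_square:
  assumes "1 \<le> \<beta>" "0 < d"
  shows "(block_size d \<beta> k)\<^sup>2 * (level \<beta> (Suc k))\<^sup>2 = 2 * loglog (level \<beta> (Suc k)) / (1 + 7 * d)"
proof -
  have "exp (exp 1) \<le> level \<beta> (Suc k)" by (rule level_ge[OF assms(1)])
  then have "0 < level \<beta> (Suc k)" "1 \<le> loglog (level \<beta> (Suc k))"
    by (meson exp_gt_zero less_le_trans, rule loglog_ge_1)
  then show ?thesis using assms by (simp add: block_size_def power_divide)
qed

lemma block_size_pos:
  assumes "1 \<le> \<beta>" "0 < d" shows "0 < block_size d \<beta> k"
proof -
  have "exp (exp 1) \<le> level \<beta> (Suc k)" by (rule level_ge[OF assms(1)])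
  then have "0 < level \<beta> (Suc k)" "1 \<le> loglog (level \<beta> (Suc k))"
    by (meson exp_gt_zero less_le_trans, rule loglog_ge_1)
  then show ?thesis using assms by (simp add: block_size_def)
qed

lemma block_stake_disjoint:
  assumes "1 \<le> \<beta>" "block_stake X m \<eta> d \<beta> k i \<omega> \<noteq> 0" "block_stake X m \<eta> d \<beta> l i \<omega> \<noteq> 0"
  shows "k = l"
proof -
  have *: "\<not> k < l" if "block_stake X m \<eta> d \<beta> k i \<omega> \<noteq> 0" "block_stake X m \<eta> d \<beta> l i \<omega> \<noteq> 0" for k l
    using that level_mono[OF assms(1), of "Suc k" l] by (auto simp: block_stake_def Suc_le_eq split: if_splits)
  show ?thesis using *[OF assms(2,3)] *[OF assms(3,2)] by simp
qed

text \<open>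
As long as \<open>V\<close> is below the upper end \<open>t\<close>, the squared gains sum to at most \<open>t\<^sup>2\<close> times the squared stake; only the last gain,
which takes \<open>V\<close> across the upper end, is not covered by this and contributes \<open>\<eta>\<^sup>2\<close>.
\<close>

lemma block_sum_of_squares_le:
  assumes "\<And>i. 1 \<le> i \<Longrightarrow> \<bar>block_stake X m \<eta> d \<beta> k i \<omega> * X i \<omega>\<bar> \<le> \<eta>"
  shows "(\<Sum>i=1..n. (block_stake X m \<eta> d \<beta> k i \<omega> * X i \<omega>)\<^sup>2)
    \<le> (block_size d \<beta> k)\<^sup>2 * (level \<beta> (Suc k))\<^sup>2 + \<eta>\<^sup>2"
proof (induction n)
  case (Suc n)
  let ?s = "\<lambda>i. block_stake X m \<eta> d \<beta> k i \<omega>"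
  show ?case
  proof (cases "?s (Suc n) = 0")
    case False
    then have V: "self_norm X n \<omega> < level \<beta> (Suc k)" by (auto simp: block_stake_def split: if_splits)
    have "(\<Sum>i=1..n. (?s i * X i \<omega>)\<^sup>2) \<le> (\<Sum>i=1..n. (block_size d \<beta> k)\<^sup>2 * (X i \<omega>)\<^sup>2)"
      unfolding power_mult_distrib by (intro sum_mono mult_right_mono) (auto simp: block_stake_def)
    also have "\<dots> = (block_size d \<beta> k)\<^sup>2 * (self_norm X n \<omega>)\<^sup>2"
      by (simp add: self_norm_square sum_distrib_left)
    also have "\<dots> \<le> (block_size d \<beta> k)\<^sup>2 * (level \<beta> (Suc k))\<^sup>2"
      using V self_norm_nonneg[of X n \<omega>] by (intro mult_left_mono power_mono) auto
    moreover have "(?s (Suc n) * X (Suc n) \<omega>)\<^sup>2 \<le> \<eta>\<^sup>2"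
      using assms[of "Suc n"] by (intro power2_le_iff_abs_le[THEN iffD2]) (auto intro: order_trans)
    ultimately show ?thesis by simp
  qed (use Suc in simp)
qed simp

lemma mult_sqrt_loglog_le:
  assumes t: "exp (exp 1) \<le> t" and V: "t \<le> V" "V \<le> c * t"
  shows "V * sqrt (loglog V) \<le> c\<^sup>2 * (t * sqrt (loglog t))"
proof -
  have t0: "0 < t" using t by (meson exp_gt_zero less_le_trans)
  have L: "1 \<le> loglog t" by (rule loglog_ge_1[OF t])
  have "sqrt (loglog V) \<le> sqrt (loglog t * (V / t)\<^sup>2)"
    using loglog_growth[OF t V(1)] by simp
  also have "\<dots> = sqrt (loglog t) * (V / t)" using t0 V by (simp add: real_sqrt_mult)
  finally have "V * sqrt (loglog V) \<le> V * (sqrt (loglog t) * (V / t))"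
    using t0 V by (intro mult_left_mono) auto
  also have "\<dots> = V\<^sup>2 * (sqrt (loglog t) / t)" by (simp add: power2_eq_square)
  also have "\<dots> \<le> (c * t)\<^sup>2 * (sqrt (loglog t) / t)"
    using t0 V L by (intro mult_right_mono power_mono) auto
  also have "\<dots> = c\<^sup>2 * (t * sqrt (loglog t))" using t0 by (simp add: power2_eq_square)
  finally show ?thesis .
qed

text \<open>
The numerical heart of the choice \<open>\<beta> = 40 / \<kappa>\<close> and \<open>d = \<kappa> / 40\<close>. Here \<open>l * S\<close> is the total gain in a
block and \<open>Q\<close> its sum of squares. Relative to \<open>L\<close>, the left side is about \<open>2 - \<kappa>\<close>, with
a loss of \<open>6 * d\<close> from the value of \<open>S\<close> at the beginning of the block, and the right side is about
\<open>2\<close>, with losses of \<open>18 * d\<close> from the tilt and \<open>3/10 * \<kappa>\<close> from the constant; the losses sum to less than \<open>\<kappa>\<close>.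
\<close>

lemma block_parameters:
  assumes \<kappa>: "0 < \<kappa>" "\<kappa> \<le> 1" and d: "d = \<kappa> / 40" and a: "a = 1 / (1 + 7 * d)"
    and L: "0 < L" and c: "c \<le> 3/10 * \<kappa> * L"
    and S: "l * S \<le> sqrt a * L * (2 * (1 - \<kappa>) * (1 + \<kappa> / 6)\<^sup>2 + 6 * d)"
    and Q: "2 * a * L * (1 - 2 * d\<^sup>2) \<le> Q"
  shows "l * S \<le> (2 - 3 * d) * (Q / 2) - c"
proof -
  have d0: "0 < d" "d \<le> 1/40" using \<kappa> by (auto simp: d)
  have a01: "0 < a" "a \<le> 1" "1 - 7 * d \<le> a"
    using d0 unfolding a by (auto simp: field_simps)
  have "(1 - \<kappa>) * (1 + \<kappa> / 6)\<^sup>2 \<le> 1 - \<kappa> / 2"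
  proof -
    have "1 - \<kappa> / 2 - (1 - \<kappa>) * (1 + \<kappa> / 6)\<^sup>2 = \<kappa> / 6 + \<kappa> * \<kappa> * (11 / 36 + \<kappa> / 36)"
      by (simp add: power2_eq_square field_simps)
    moreover have "0 \<le> \<kappa> / 6 + \<kappa> * \<kappa> * (11 / 36 + \<kappa> / 36)" using \<kappa> by (intro add_nonneg_nonneg mult_nonneg_nonneg) auto
    ultimately show ?thesis by linarith
  qed
  then have b1: "2 * (1 - \<kappa>) * (1 + \<kappa> / 6)\<^sup>2 + 6 * d \<le> 2 - \<kappa> + 6 * d"
    unfolding mult.assoc by linarith
  have b0: "0 \<le> 2 * (1 - \<kappa>) * (1 + \<kappa> / 6)\<^sup>2 + 6 * d" using \<kappa> d0 by simp
  have "sqrt a * L * (2 * (1 - \<kappa>) * (1 + \<kappa> / 6)\<^sup>2 + 6 * d) \<le> 1 * L * (2 - \<kappa> + 6 * d)"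
    using b0 b1 a01 L by (intro mult_mono) auto
  then have 1: "l * S \<le> L * (2 - \<kappa> + 6 * d)" using S by simp
  have dd: "d * d \<le> d / 40" "0 \<le> d * d" using d0 by auto
  have dd1: "0 \<le> 1 - 2 * d\<^sup>2" unfolding power2_eq_square using dd d0 by linarith
  have "2 - 18 * d \<le> (2 - 3 * d) * (a * (1 - 2 * d\<^sup>2))"
  proof -
    have "2 - 18 * d \<le> (2 - 17 * d) * (1 - 2 * d\<^sup>2)"
    proof -
      have "(2 - 17 * d) * (1 - 2 * d\<^sup>2) = 2 - 17 * d - 4 * (d * d) + 34 * (d * (d * d))"
        by (simp add: algebra_simps power2_eq_square)
      moreover have "0 \<le> d * (d * d)" using d0 by simp
      ultimately show ?thesis using dd d0 by linarith
    qed
    also have "\<dots> \<le> ((2 - 3 * d) * (1 - 7 * d)) * (1 - 2 * d\<^sup>2)"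
      using dd dd1 by (intro mult_right_mono) (auto simp: algebra_simps)
    also have "\<dots> \<le> ((2 - 3 * d) * a) * (1 - 2 * d\<^sup>2)"
      using a01 dd1 d0 by (intro mult_right_mono mult_left_mono) auto
    finally show ?thesis by (simp add: mult_ac)
  qed
  then have "L * (2 - 18 * d) \<le> L * ((2 - 3 * d) * (a * (1 - 2 * d\<^sup>2)))" using L by (intro mult_left_mono) auto
  also have "\<dots> = (2 - 3 * d) * ((2 * a * L * (1 - 2 * d\<^sup>2)) / 2)" by simp
  also have "\<dots> \<le> (2 - 3 * d) * (Q / 2)"
    using Q d0 by (intro mult_left_mono divide_right_mono) auto
  finally have 2: "L * (2 - 18 * d) \<le> (2 - 3 * d) * (Q / 2)" .
  have "L * (2 - \<kappa> + 6 * d) + 3/10 * \<kappa> * L \<le> L * (2 - 18 * d)"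
    using \<kappa> L by (simp add: d algebra_simps)
  then show ?thesis using 1 2 c by linarith
qed

text \<open>
Let \<open>p\<close> and \<open>q\<close> be the times at which \<open>V\<close> reaches the two ends \<open>u\<close> and \<open>t = \<beta> * u\<close> of the block. After
time \<open>q\<close> the gain is \<open>l * (S q - S p)\<close>. The assumed upper bound at \<open>q\<close> and the lower bound at
\<open>p\<close>, which is of smaller order since \<open>\<beta>\<close> is large, keep this below the threshold of \<open>tilt_nonpos\<close>.
\<close>

lemma block_tilt_eventually_nonpos:
  assumes r: "regular_path X m \<omega>" and \<kappa>: "0 < \<kappa>" "\<kappa> \<le> 1" and \<eta>: "0 < \<eta>"
    and d: "d = \<kappa> / 40" and \<beta>: "\<beta> = 40 / \<kappa>"
    and upper: "\<forall>\<^sub>F n in sequentially. partial_sum X n \<omega>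
        \<le> sqrt 2 * (1 - \<kappa>) * (self_norm X n \<omega> * sqrt (loglog (self_norm X n \<omega>)))"
    and lower: "\<forall>\<^sub>F n in sequentially. - partial_sum X n \<omega>
        \<le> 2 * (self_norm X n \<omega> * sqrt (loglog (self_norm X n \<omega>)))"
  shows "\<forall>\<^sub>F k in sequentially. \<forall>\<^sub>F n in sequentially.
     tilt d (\<lambda>i. block_stake X m \<eta> d \<beta> k i \<omega> * X i \<omega>) n \<le> 0"
proof -
  define V where "V n = self_norm X n \<omega>" for n
  define S where "S n = partial_sum X n \<omega>" for n
  have \<beta>40: "40 \<le> \<beta>" using \<kappa> by (simp add: \<beta> field_simps)
  then have \<beta>1: "1 < \<beta>" by simp
  have d0: "0 < d" "d \<le> 1" using \<kappa> by (auto simp: d)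
  have Vmono: "V i \<le> V n" if "i \<le> n" for i n unfolding V_def by (rule self_norm_mono[OF that])
  have Vnn: "0 \<le> V n" for n unfolding V_def by (rule self_norm_nonneg)
  have V_top: "filterlim V at_top sequentially" using r by (simp add: regular_path_def V_def[abs_def])
  have "\<forall>\<^sub>F n in sequentially. V n \<le> (1 + \<kappa> / 6) * V (n - 1)"
    unfolding V_def using regular_path_steps[OF r, of "\<kappa> / 6"] \<kappa> by simp
  from eventually_conj[OF this eventually_conj[OF upper lower]]
  obtain N where N: "\<And>n. N \<le> n \<Longrightarrow> V n \<le> (1 + \<kappa> / 6) * V (n - 1)"
    "\<And>n. N \<le> n \<Longrightarrow> S n \<le> sqrt 2 * (1 - \<kappa>) * (V n * sqrt (loglog (V n)))"
    "\<And>n. N \<le> n \<Longrightarrow> - S n \<le> 2 * (V n * sqrt (loglog (V n)))"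
    unfolding eventually_sequentially V_def S_def by blast
  have ev1: "\<forall>\<^sub>F k in sequentially. V N < level \<beta> k"
    using filterlim_level[OF \<beta>1] by (simp add: filterlim_at_top_dense)
  have Suc_top: "filterlim (\<lambda>k. level \<beta> (Suc k)) at_top sequentially"
    using filterlim_level[OF \<beta>1] by (simp add: filterlim_sequentially_Suc)
  have "filterlim loglog at_top at_top" unfolding loglog_def[abs_def] by real_asymp
  then have "filterlim (\<lambda>k. loglog (level \<beta> (Suc k))) at_top sequentially"
    using Suc_top by (rule filterlim_compose)
  then have ev2: "\<forall>\<^sub>F k in sequentially. ln 4 / d / (3/10 * \<kappa>) \<le> loglog (level \<beta> (Suc k))"
    by (simp add: filterlim_at_top)
  have ev3: "\<forall>\<^sub>F k in sequentially. \<forall>i\<ge>1. V i \<le> 2 * level \<beta> (Suc k) \<longrightarrow>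
      sqrt (loglog (level \<beta> (Suc k))) / level \<beta> (Suc k) * m i \<omega> \<le> \<eta> / sqrt 2"
    unfolding V_def
    using eventually_compose_filterlim[OF regular_path_stakes_small[OF r, of "\<eta> / sqrt 2"] Suc_top] \<eta>
    by simp
  from ev1 ev2 ev3 show ?thesis
  proof eventually_elim
    case (elim k)
    define t where "t = level \<beta> (Suc k)"
    define u where "u = level \<beta> k"
    define L where "L = loglog t"
    define l where "l = block_size d \<beta> k"
    define a where "a = 1 / (1 + 7 * d)"
    have a: "0 < a" "a \<le> 1" using d0 by (simp_all add: a_def)
    have tu: "t = \<beta> * u" by (simp add: t_def u_def level_Suc)
    have u_ge: "exp (exp 1) \<le> u" unfolding u_def using \<beta>1 by (intro level_ge) simp
    have t_ge: "exp (exp 1) \<le> t" unfolding t_def using \<beta>1 by (intro level_ge) simp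
    have u0: "0 < u" using u_ge by (meson exp_gt_zero less_le_trans)
    have t0: "0 < t" using t_ge by (meson exp_gt_zero less_le_trans)
    have ut: "u \<le> t" unfolding t_def u_def using \<beta>1 by (intro level_mono) auto
    have ud: "u = d * t" using \<kappa> by (simp add: tu d \<beta>)
    have L1: "1 \<le> L" unfolding L_def by (rule loglog_ge_1[OF t_ge])
    have Lu: "1 \<le> loglog u" by (rule loglog_ge_1[OF u_ge])
    have LuL: "loglog u \<le> L" unfolding L_def by (rule loglog_mono[OF u_ge ut])
    have l0: "0 < l" unfolding l_def using \<beta>1 d0 by (intro block_size_pos) auto
    have lt: "l * t = sqrt (2 * a * L)" using t0 by (simp add: l_def block_size_def t_def L_def a_def)
    have l2t2: "l\<^sup>2 * t\<^sup>2 = 2 * a * L"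
      using block_size_square[of \<beta> d k] \<beta>1 d0 by (simp add: l_def t_def L_def a_def)
    define p where "p = (LEAST n. u \<le> V n)"
    define q where "q = (LEAST n. t \<le> V n)"
    have exV: "\<exists>n. x \<le> V n" for x
      using V_top unfolding filterlim_at_top eventually_sequentially by blast
    have p: "u \<le> V p" unfolding p_def by (rule LeastI_ex[OF exV])
    have q: "t \<le> V q" unfolding q_def by (rule LeastI_ex[OF exV])
    have p_iff: "u \<le> V n \<longleftrightarrow> p \<le> n" for n
      using p Vmono[of p n] unfolding p_def by (auto intro: Least_le)
    have q_iff: "t \<le> V n \<longleftrightarrow> q \<le> n" for n
      using q Vmono[of q n] unfolding q_def by (auto intro: Least_le)
    have pq: "p \<le> q" using q ut p_iff[of q] by linarith
    have Np: "N < p" using elim(1) p_iff[of N] by (simp add: u_def)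
    have Vp: "V p \<le> (1 + \<kappa> / 6) * u"
    proof -
      have "\<not> u \<le> V (p - 1)" unfolding p_iff using Np by linarith
      then have "V (p - 1) < u" by simp
      then have "(1 + \<kappa> / 6) * V (p - 1) \<le> (1 + \<kappa> / 6) * u" using \<kappa> by (intro mult_left_mono) auto
      then show ?thesis using N(1)[of p] Np by linarith
    qed
    have Vq: "V q \<le> (1 + \<kappa> / 6) * t"
    proof -
      have "\<not> t \<le> V (q - 1)" unfolding q_iff using Np pq by linarith
      then have "V (q - 1) < t" by simp
      then have "(1 + \<kappa> / 6) * V (q - 1) \<le> (1 + \<kappa> / 6) * t" using \<kappa> by (intro mult_left_mono) auto
      then show ?thesis using N(1)[of q] Np pq by linarith
    qed
    define y where "y i = block_stake X m \<eta> d \<beta> k i \<omega> * X i \<omega>" for i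
    have y: "y i = (if p < i \<and> i \<le> q then l * X i \<omega> else 0)" if i: "1 \<le> i" for i
    proof -
      have cond: "(level \<beta> k \<le> self_norm X (i - 1) \<omega> \<and> self_norm X (i - 1) \<omega> < level \<beta> (Suc k))
          \<longleftrightarrow> p < i \<and> i \<le> q"
        using p_iff[of "i - 1"] q_iff[of "i - 1"] i unfolding u_def t_def V_def by auto
      have "block_size d \<beta> k * m i \<omega> \<le> \<eta>" if iq: "i \<le> q"
      proof -
        have "V i \<le> (1 + \<kappa> / 6) * t" using Vmono[OF iq] Vq by linarith
        also have "\<dots> \<le> 2 * t" using \<kappa> t0 by (intro mult_right_mono) auto
        finally have *: "sqrt L / t * m i \<omega> \<le> \<eta> / sqrt 2"
          using elim(3) i unfolding t_def L_def by blast
        have m0: "0 \<le> m i \<omega>" using r i unfolding regular_path_def by force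
        have "l = sqrt (2 * a * L) / t" using lt t0 by (simp add: field_simps)
        also have "\<dots> \<le> sqrt (2 * L) / t" using a L1 t0 by (intro divide_right_mono real_sqrt_le_mono) auto
        also have "\<dots> = sqrt 2 * (sqrt L / t)" by (simp add: real_sqrt_mult)
        finally have "l * m i \<omega> \<le> sqrt 2 * (sqrt L / t) * m i \<omega>" using m0 by (intro mult_right_mono)
        also have "\<dots> = sqrt 2 * (sqrt L / t * m i \<omega>)" by simp
        also have "\<dots> \<le> sqrt 2 * (\<eta> / sqrt 2)" using * by (intro mult_left_mono) auto
        finally show ?thesis by (simp add: l_def)
      qed
      then show ?thesis unfolding y_def block_stake_def cond by (simp add: l_def)
    qed
    have split: "(\<Sum>i=1..n. if p < i \<and> i \<le> q then h i else 0) = (\<Sum>i=1..q. h i) - (\<Sum>i=1..p. h i)"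
      if "q \<le> n" for n and h :: "nat \<Rightarrow> real"
    proof -
      have "(\<Sum>i=1..n. if p < i \<and> i \<le> q then h i else 0) = (\<Sum>i\<in>{p<..q}. h i)"
        using that by (intro sum.mono_neutral_cong_right) auto
      moreover have "(\<Sum>i=1..q. h i) = (\<Sum>i=1..p. h i) + (\<Sum>i\<in>{p<..q}. h i)"
        using pq by (subst sum.union_disjoint[symmetric]) (auto intro!: sum.cong)
      ultimately show ?thesis by simp
    qed
    have main: "tilt d y n \<le> 0" if n: "q \<le> n" for n
    proof -
      have s1: "(\<Sum>i=1..n. y i) = l * (S q - S p)"
      proof -
        have "(\<Sum>i=1..n. y i) = (\<Sum>i=1..n. if p < i \<and> i \<le> q then l * X i \<omega> else 0)"
          by (rule sum.cong) (auto simp: y)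
        then show ?thesis unfolding split[OF n] S_def partial_sum_def
          by (simp add: sum_distrib_left right_diff_distrib)
      qed
      have s2: "(\<Sum>i=1..n. (y i)\<^sup>2) = l\<^sup>2 * ((V q)\<^sup>2 - (V p)\<^sup>2)"
      proof -
        have "(\<Sum>i=1..n. (y i)\<^sup>2) = (\<Sum>i=1..n. if p < i \<and> i \<le> q then l\<^sup>2 * (X i \<omega>)\<^sup>2 else 0)"
          by (rule sum.cong) (auto simp: y power_mult_distrib)
        then show ?thesis unfolding split[OF n] V_def self_norm_square
          by (simp add: sum_distrib_left right_diff_distrib)
      qed
      have iota: "(1 + \<kappa> / 6)\<^sup>2 \<le> 2"
      proof -
        have "\<kappa> * \<kappa> \<le> 1" using \<kappa> by (simp add: mult_le_one)
        then show ?thesis using \<kappa> by (simp add: power2_eq_square algebra_simps)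
      qed
      have Sq: "S q \<le> sqrt 2 * (1 - \<kappa>) * ((1 + \<kappa> / 6)\<^sup>2 * (t * sqrt L))"
      proof -
        have "V q * sqrt (loglog (V q)) \<le> (1 + \<kappa> / 6)\<^sup>2 * (t * sqrt L)"
          unfolding L_def by (rule mult_sqrt_loglog_le[OF t_ge q Vq])
        then have "sqrt 2 * (1 - \<kappa>) * (V q * sqrt (loglog (V q)))
            \<le> sqrt 2 * (1 - \<kappa>) * ((1 + \<kappa> / 6)\<^sup>2 * (t * sqrt L))"
          using \<kappa> by (intro mult_left_mono) auto
        then show ?thesis using N(2)[of q] Np pq by linarith
      qed
      have Sp: "- S p \<le> 4 * (d * (t * sqrt L))"
      proof -
        have "V p * sqrt (loglog (V p)) \<le> (1 + \<kappa> / 6)\<^sup>2 * (u * sqrt (loglog u))"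
          by (rule mult_sqrt_loglog_le[OF u_ge p Vp])
        also have "\<dots> \<le> 2 * (u * sqrt L)"
          using iota u0 LuL Lu by (intro mult_mono) auto
        finally show ?thesis using N(3)[of p] Np ud by simp
      qed
      have "l * (S q - S p) \<le> l * (sqrt 2 * (1 - \<kappa>) * ((1 + \<kappa> / 6)\<^sup>2 * (t * sqrt L)) + 4 * (d * (t * sqrt L)))"
        using Sq Sp l0 by (intro mult_left_mono) auto
      also have "\<dots> = (l * t) * sqrt L * (sqrt 2 * (1 - \<kappa>) * (1 + \<kappa> / 6)\<^sup>2 + 4 * d)"
        by (simp add: algebra_simps)
      also have "(l * t) * sqrt L = sqrt a * L * sqrt 2"
        unfolding lt using L1 by (simp add: real_sqrt_mult)
      also have "sqrt a * L * sqrt 2 * (sqrt 2 * (1 - \<kappa>) * (1 + \<kappa> / 6)\<^sup>2 + 4 * d)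
          = sqrt a * L * (2 * (1 - \<kappa>) * (1 + \<kappa> / 6)\<^sup>2 + 4 * sqrt 2 * d)"
      proof -
        have "sqrt 2 * (sqrt 2 * (1 - \<kappa>) * (1 + \<kappa> / 6)\<^sup>2 + 4 * d)
            = (sqrt 2 * sqrt 2) * ((1 - \<kappa>) * (1 + \<kappa> / 6)\<^sup>2) + 4 * sqrt 2 * d"
          by (simp only: distrib_left mult_ac)
        then show ?thesis by (simp add: mult.assoc)
      qed
      also have "\<dots> \<le> sqrt a * L * (2 * (1 - \<kappa>) * (1 + \<kappa> / 6)\<^sup>2 + 6 * d)"
      proof -
        have "sqrt 2 \<le> 3/2" by (rule real_le_lsqrt) (auto simp: power2_eq_square)
        then have "4 * sqrt 2 * d \<le> 6 * d" using d0 by (intro mult_right_mono) auto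
        then show ?thesis using a L1 by (intro mult_left_mono) auto
      qed
      finally have A: "l * (S q - S p) \<le> sqrt a * L * (2 * (1 - \<kappa>) * (1 + \<kappa> / 6)\<^sup>2 + 6 * d)" .
      have B: "2 * a * L * (1 - 2 * d\<^sup>2) \<le> l\<^sup>2 * ((V q)\<^sup>2 - (V p)\<^sup>2)"
      proof -
        have "(V p)\<^sup>2 \<le> ((1 + \<kappa> / 6) * u)\<^sup>2" using Vp Vnn by (intro power_mono) auto
        also have "\<dots> \<le> 2 * u\<^sup>2" unfolding power_mult_distrib using iota by (intro mult_right_mono) auto
        finally have "(V p)\<^sup>2 \<le> 2 * d\<^sup>2 * t\<^sup>2" by (simp add: ud power_mult_distrib)
        moreover have "t\<^sup>2 \<le> (V q)\<^sup>2" using q t0 by (intro power_mono) auto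
        ultimately have "t\<^sup>2 * (1 - 2 * d\<^sup>2) \<le> (V q)\<^sup>2 - (V p)\<^sup>2" by (simp add: algebra_simps)
        then have "l\<^sup>2 * (t\<^sup>2 * (1 - 2 * d\<^sup>2)) \<le> l\<^sup>2 * ((V q)\<^sup>2 - (V p)\<^sup>2)" by (intro mult_left_mono) auto
        then show ?thesis unfolding l2t2[symmetric] by (simp add: mult.assoc)
      qed
      have "l * (S q - S p) \<le> (2 - 3 * d) * (l\<^sup>2 * ((V q)\<^sup>2 - (V p)\<^sup>2) / 2) - ln 4 / d"
      proof (rule block_parameters[OF \<kappa> d a_def])
        show "0 < L" using L1 by linarith
        have "0 < 3/10 * \<kappa>" using \<kappa> by simp
        then show "ln 4 / d \<le> 3/10 * \<kappa> * L"
          using elim(2) unfolding L_def t_def by (simp only: pos_divide_le_eq mult.commute)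
      qed (use A B in simp_all)
      then show ?thesis
        using d0 by (intro tilt_nonpos) (simp_all only: s1 s2)
    qed
    show ?case unfolding eventually_sequentially y_def[symmetric] using main by blast
  qed
qed

context dominated_mds begin

lemma neg_dominated_mds: "dominated_mds M F (\<lambda>n \<omega>. - X n \<omega>) m"
proof (rule dominated_mds.intro)
  show "prob_space M" by (rule prob_M)
  show "AE \<omega> in M. \<bar>- X n \<omega>\<bar> \<le> m n \<omega>" if "n \<ge> 1" for n using X_le[OF that] by simp
  show "martingale_difference_seq M F (\<lambda>n \<omega>. - X n \<omega>)"
    unfolding martingale_difference_seq_def
  proof (intro conjI allI impI)
    show "filtration (space M) F" using mds by (simp add: martingale_difference_seq_def)
    show "subalgebra M (F n)" for n by (rule subalg)
    fix n :: nat assume n: "1 \<le> n"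
    show "(\<lambda>\<omega>. - X n \<omega>) \<in> borel_measurable (F n)" using X_meas[OF n] by simp
    show "integrable M (\<lambda>\<omega>. - X n \<omega>)" using X_int[OF n] by simp
    interpret sigma_finite_subalgebra M "F (n - 1)"
      by (rule finite_measure_subalgebra_is_sigma_finite)
         (simp add: finite_measure_subalgebra_def finite_measure_subalgebra_axioms_def finite_measure_axioms subalg)
    have "AE \<omega> in M. real_cond_exp M (F (n - 1)) (X n) \<omega> = 0"
      using mds n by (simp add: martingale_difference_seq_def)
    moreover have "AE \<omega> in M. real_cond_exp M (F (n - 1)) (\<lambda>\<omega>. - 1 * X n \<omega>) \<omega>
        = - 1 * real_cond_exp M (F (n - 1)) (X n) \<omega>"
      by (rule real_cond_exp_cmult[OF X_int[OF n]])
    ultimately show "AE \<omega> in M. real_cond_exp M (F (n - 1)) (\<lambda>\<omega>. - X n \<omega>) \<omega> = 0"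
      by eventually_elim simp
  qed
qed (rule m_meas)

text \<open>
The tilts are positive in infinitely many blocks because the sum of \<open>1 / b k\<close> diverges, while an eventual
upper bound on \<open>S\<close> would make all but finitely many of them eventually nonpositive. The bound \<open>- S n \<le> 2 * V n * sqrt (loglog (V n))\<close>
needed at the beginning of each block is the upper half for \<open>- X\<close> with \<open>e = 1/5\<close>, since
\<open>sqrt 2 * (7/5) \<le> 2\<close>.
\<close>

lemma lower_half:
  assumes regular: "AE \<omega> in M. regular_path X m \<omega>" and \<kappa>: "0 < \<kappa>" "\<kappa> \<le> 1"
  shows "AE \<omega> in M. \<exists>\<^sub>F n in sequentially.
    sqrt 2 * (1 - \<kappa>) * (self_norm X n \<omega> * sqrt (loglog (self_norm X n \<omega>))) < partial_sum X n \<omega>"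
proof -
  define d where "d = \<kappa> / 40"
  define \<beta> where "\<beta> = 40 / \<kappa>"
  have d: "0 < d" "d \<le> 1/4" using \<kappa> by (auto simp: d_def)
  have \<beta>: "1 < \<beta>" using \<kappa> by (simp add: \<beta>_def field_simps)
  have "0 < d\<^sup>2" using d by simp
  then obtain \<delta> where \<delta>: "0 < \<delta>" "\<delta> \<le> 1"
    and up: "\<And>y. \<bar>y\<bar> \<le> \<delta> \<Longrightarrow> exp (y - (1 + d\<^sup>2) * y\<^sup>2 / 2) \<le> 1 + y"
    and lo: "\<And>y. \<bar>y\<bar> \<le> \<delta> \<Longrightarrow> 1 + y \<le> exp (y - (1 - d\<^sup>2) * y\<^sup>2 / 2)"
    using exp_quadratic_bounds by metis
  define s where "s = block_stake X m (\<delta> / 2) d \<beta>"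
  have s: "small_stakes (\<delta> / 2) (s k)" for k
    unfolding s_def block_stake_def[abs_def]
  proof (rule gated_small_stakes)
    show "0 \<le> block_size d \<beta> k" using block_size_pos[of \<beta> d k] \<beta> d by simp
    fix i :: nat assume "1 \<le> i"
    have [measurable]: "self_norm X (i - 1) \<in> borel_measurable (F (i - 1))" by (rule self_norm_meas)
    show "Measurable.pred (F (i - 1))
        (\<lambda>\<omega>. level \<beta> k \<le> self_norm X (i - 1) \<omega> \<and> self_norm X (i - 1) \<omega> < level \<beta> (Suc k))"
      by measurable
  qed (use \<delta> in simp)
  define C where "C = exp (ln 4 / d + (1 + 7 * d) / 2)"
  define b where "b k = C * (exp 1 + real (Suc k) * ln \<beta>)" for k
  have lb: "0 < ln \<beta>" using \<beta> by simp
  have C0: "0 < C" by (simp add: C_def)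
  have b0: "0 < b k" for k unfolding b_def using C0 lb by (intro mult_pos_pos add_pos_nonneg) auto
  have "AE \<omega> in M. \<exists>\<^sub>\<infinity>k. \<exists>\<^sub>\<infinity>n. 0 < tilt d (\<lambda>i. s k i \<omega> * X i \<omega>) n"
  proof (rule tilt_positive_infinitely_often[OF s])
    show "k = l" if "s k i \<omega> \<noteq> 0" "s l i \<omega> \<noteq> 0" for k l i \<omega>
      using that unfolding s_def by (rule block_stake_disjoint[OF less_imp_le[OF \<beta>]])
    show "AE \<omega> in M. tilt d (\<lambda>i. s k i \<omega> * X i \<omega>) n \<le> b k" for k n
      using small_stakes_AE[OF s[of k]]
    proof eventually_elim
      case (elim \<omega>)
      define L where "L = loglog (level \<beta> (Suc k))"
      have "(\<Sum>i=1..n. (s k i \<omega> * X i \<omega>)\<^sup>2) \<le> 2 * L / (1 + 7 * d) + (\<delta> / 2)\<^sup>2"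
        unfolding L_def block_size_square[OF less_imp_le[OF \<beta>] d(1), symmetric] s_def
        by (rule block_sum_of_squares_le) (use elim in \<open>simp add: s_def\<close>)
      moreover have "(\<delta> / 2)\<^sup>2 \<le> 1" using \<delta> by (simp add: power_le_one)
      ultimately have "(\<Sum>i=1..n. (s k i \<omega> * X i \<omega>)\<^sup>2) / 2 \<le> L / (1 + 7 * d) + 1 / 2"
        unfolding times_divide_eq_right[symmetric] by linarith
      then have "tilt d (\<lambda>i. s k i \<omega> * X i \<omega>) n \<le> exp (ln 4 / d + (1 + 7 * d) * (L / (1 + 7 * d) + 1 / 2))"
        using d by (intro tilt_le) auto
      also have "ln 4 / d + (1 + 7 * d) * (L / (1 + 7 * d) + 1 / 2) = ln 4 / d + (1 + 7 * d) / 2 + L"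
        using d by (simp add: distrib_left)
      also have "exp \<dots> = b k"
        using exp_loglog_level[of \<beta> "Suc k"] \<beta> by (simp add: exp_add C_def b_def L_def)
      finally show ?case .
    qed
    show "\<not> summable (\<lambda>k. 1 / b k)"
    proof
      assume sm: "summable (\<lambda>k. 1 / b k)"
      define D where "D = C * (exp 1 + ln \<beta>)"
      have D: "0 < D" unfolding D_def using C0 lb by (intro mult_pos_pos add_pos_nonneg) auto
      have "summable (\<lambda>k. 1 / (D * real (Suc k)))"
      proof (rule summable_comparison_test[OF _ sm], intro exI allI impI)
        fix k
        have "b k \<le> D * real (Suc k)"
        proof -
          have "exp 1 + real (Suc k) * ln \<beta> \<le> (exp 1 + ln \<beta>) * real (Suc k)"
            by (simp add: algebra_simps)
          then show ?thesis unfolding b_def D_def mult.assoc using C0 by (intro mult_left_mono) auto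
        qed
        then show "norm (1 / (D * real (Suc k))) \<le> 1 / b k"
          using D b0[of k] by (simp add: frac_le)
      qed
      then have "summable (\<lambda>k. D * (1 / (D * real (Suc k))))" by (rule summable_mult)
      then have "summable (\<lambda>k. inverse (real (Suc k)))" using D by (simp add: inverse_eq_divide)
      then have "summable (\<lambda>k. inverse (real k))" by (subst (asm) summable_Suc_iff)
      then show False using not_summable_harmonic[where 'a = real] by simp
    qed
  qed (use d up lo b0 in auto)
  moreover have "AE \<omega> in M. \<forall>\<^sub>F n in sequentially. - partial_sum X n \<omega>
      \<le> sqrt 2 * (1 + 2 * (1/5)) * (self_norm X n \<omega> * sqrt (loglog (self_norm X n \<omega>)))"
  proof -
    interpret neg: dominated_mds M F "\<lambda>n \<omega>. - X n \<omega>" m by (rule neg_dominated_mds)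
    have V: "self_norm (\<lambda>n \<omega>. - X n \<omega>) = self_norm X" by (simp add: self_norm_def fun_eq_iff)
    have S: "partial_sum (\<lambda>n \<omega>. - X n \<omega>) n \<omega> = - partial_sum X n \<omega>" for n \<omega>
      by (simp add: partial_sum_def sum_negf)
    have R: "regular_path (\<lambda>n \<omega>. - X n \<omega>) m \<omega> \<longleftrightarrow> regular_path X m \<omega>" for \<omega>
      by (simp add: regular_path_def V)
    show ?thesis using neg.upper_half[of "1/5", unfolded V S R, OF regular] by simp
  qed
  ultimately show ?thesis using regular
  proof eventually_elim
    case (elim \<omega>)
    show ?case
    proof (rule ccontr)
      assume "\<not> ?case"
      then have U: "\<forall>\<^sub>F n in sequentially. partial_sum X n \<omega>
          \<le> sqrt 2 * (1 - \<kappa>) * (self_norm X n \<omega> * sqrt (loglog (self_norm X n \<omega>)))"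
        by (simp add: not_frequently not_less)
      have W: "\<forall>\<^sub>F n in sequentially. - partial_sum X n \<omega>
          \<le> 2 * (self_norm X n \<omega> * sqrt (loglog (self_norm X n \<omega>)))"
        using elim(2) regular_path_small_increments[OF elim(3) zero_less_one]
      proof eventually_elim
        case (elim n)
        have "sqrt 2 * (1 + 2 * (1/5)) \<le> 2"
        proof -
          have "sqrt 2 \<le> 10/7" by (rule real_le_lsqrt) (auto simp: power2_eq_square)
          then show ?thesis by simp
        qed
        moreover have "0 \<le> self_norm X n \<omega> * sqrt (loglog (self_norm X n \<omega>))"
          using loglog_ge_1[of "self_norm X n \<omega>"] elim(2) self_norm_nonneg[of X n \<omega>] by simp
        ultimately show ?case using elim(1) mult_right_mono by fastforce
      qed
      have "\<forall>\<^sub>F k in sequentially. \<forall>\<^sub>F n in sequentially. tilt d (\<lambda>i. s k i \<omega> * X i \<omega>) n \<le> 0"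
        unfolding s_def using \<delta>
        by (intro block_tilt_eventually_nonpos[OF elim(3) \<kappa> _ d_def \<beta>_def U W]) auto
      then show False
        using elim(1) by (simp add: cofinite_eq_sequentially frequently_def not_less)
    qed
  qed
qed

end

section \<open>The law of the iterated logarithm\<close>

theorem theorem6p1:
  fixes M :: "'a measure" and F :: "nat \<Rightarrow> 'a measure"
    and X m :: "nat \<Rightarrow> 'a \<Rightarrow> real"
  assumes "prob_space M"
    and "martingale_difference_seq M F X"
    and "\<And>n. n \<ge> 1 \<Longrightarrow> m n \<in> borel_measurable (F (n - 1))"
    and "\<And>n. n \<ge> 1 \<Longrightarrow> AE \<omega> in M. \<bar>X n \<omega>\<bar> \<le> m n \<omega>"
    and "AE \<omega> in M. filterlim (\<lambda>n. self_norm X n \<omega>) at_top sequentially"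
    and "AE \<omega> in M. (\<lambda>n. m n \<omega> /
           (self_norm X n \<omega> * ln (ln (self_norm X n \<omega>)) powr (- 1 / 2))) \<longlonglongrightarrow> 0"
  shows "AE \<omega> in M. limsup (\<lambda>n. ereal (partial_sum X n \<omega> /
           (self_norm X n \<omega> * ln (ln (self_norm X n \<omega>)) powr (1 / 2)))) = ereal (sqrt 2)"
proof -
  interpret dominated_mds M F X m
    using assms(1-4) by (rule dominated_mds.intro)
  define R where "R n \<omega> = partial_sum X n \<omega> /
      (self_norm X n \<omega> * ln (ln (self_norm X n \<omega>)) powr (1 / 2))" for n \<omega>
  define Z where "Z n \<omega> = self_norm X n \<omega> * sqrt (loglog (self_norm X n \<omega>))" for n \<omega>
  have "AE \<omega> in M. \<forall>n\<ge>1. \<bar>X n \<omega>\<bar> \<le> m n \<omega>"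
    using assms(4) unfolding AE_all_countable by auto
  then have regular: "AE \<omega> in M. regular_path X m \<omega>"
    using assms(5,6) by eventually_elim (simp add: regular_path_def)
  have "AE \<omega> in M. \<forall>j. \<forall>\<^sub>F n in sequentially.
      partial_sum X n \<omega> \<le> sqrt 2 * (1 + 2 * (1 / real (Suc j))) * Z n \<omega>"
    unfolding AE_all_countable Z_def by (intro allI upper_half[OF regular]) simp_all
  moreover have "AE \<omega> in M. \<forall>j. \<exists>\<^sub>F n in sequentially.
      sqrt 2 * (1 - 1 / real (Suc j)) * Z n \<omega> < partial_sum X n \<omega>"
    unfolding AE_all_countable Z_def by (intro allI lower_half[OF regular]) simp_all
  ultimately show ?thesis using regular unfolding R_def[symmetric]
  proof eventually_elim
    case (elim \<omega>)
    have R: "\<forall>\<^sub>F n in sequentially. 0 < Z n \<omega> \<and> R n \<omega> = partial_sum X n \<omega> / Z n \<omega>"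
      using regular_path_small_increments[OF elim(3) zero_less_one]
    proof eventually_elim
      case (elim n)
      then have V: "exp (exp 1) \<le> self_norm X n \<omega>" by simp
      have L: "1 \<le> loglog (self_norm X n \<omega>)" by (rule loglog_ge_1[OF V])
      have "0 < self_norm X n \<omega>" using V by (meson exp_gt_zero less_le_trans)
      then show ?case using L by (simp add: R_def Z_def powr_half_sqrt loglog_def)
    qed
    have conv: "(\<lambda>j. ereal (sqrt 2 * (1 + c * (1 / real (Suc j))))) \<longlonglongrightarrow> ereal (sqrt 2)" for c
    proof -
      have "(\<lambda>j. sqrt 2 * (1 + c * (1 / real (Suc j)))) \<longlonglongrightarrow> sqrt 2 * (1 + c * 0)"
        by (intro tendsto_intros LIMSEQ_Suc[OF lim_1_over_n])
      then show ?thesis by simp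
    qed
    show ?case
    proof (rule antisym)
      have "limsup (\<lambda>n. ereal (R n \<omega>)) \<le> ereal (sqrt 2 * (1 + 2 * (1 / real (Suc j))))" for j
      proof (rule Limsup_bounded)
        show "\<forall>\<^sub>F n in sequentially. ereal (R n \<omega>) \<le> ereal (sqrt 2 * (1 + 2 * (1 / real (Suc j))))"
          using spec[OF elim(1), of j] R by eventually_elim (simp add: pos_divide_le_eq)
      qed
      then show "limsup (\<lambda>n. ereal (R n \<omega>)) \<le> ereal (sqrt 2)"
        by (intro LIMSEQ_le_const[OF conv[of 2]]) auto
      have "ereal (sqrt 2 * (1 + - 1 * (1 / real (Suc j)))) \<le> limsup (\<lambda>n. ereal (R n \<omega>))" for j
      proof (rule ccontr)
        assume "\<not> ?thesis"
        then have "limsup (\<lambda>n. ereal (R n \<omega>)) < ereal (sqrt 2 * (1 + - 1 * (1 / real (Suc j))))"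
          by simp
        then have "\<forall>\<^sub>F n in sequentially. ereal (R n \<omega>) < ereal (sqrt 2 * (1 + - 1 * (1 / real (Suc j))))"
          by (rule Limsup_lessD)
        then have "\<forall>\<^sub>F n in sequentially. \<not> sqrt 2 * (1 - 1 / real (Suc j)) * Z n \<omega> < partial_sum X n \<omega>"
          using R by eventually_elim (simp add: pos_divide_less_eq not_less less_imp_le)
        then show False using spec[OF elim(2), of j] by (simp add: frequently_def)
      qed
      then show "ereal (sqrt 2) \<le> limsup (\<lambda>n. ereal (R n \<omega>))"
        by (intro LIMSEQ_le_const2[OF conv[of "-1"]]) auto
    qed
  qed
qed

end
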